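(* Let $k$ be a field of characteristic zero and let $P\in M_3(k)$ be a moduli point outside of the locus $\{\tilde c=0\}$. Choose weighted projective coordinates $P=[\mathbf{d}:\mathbf{i}:\mathbf{j}:\mathbf{a}:\mathbf{b}:\mathbf{c}]$ with values in $k$, and let $\tilde{\mathbf{c}},\tilde{\mathbf{A}}_i,\tilde{\mathbf{B}}_{ij},\tilde{\mathbf{C}}_{ij}\in k$ be the corresponding values of the invariants $\tilde c,\tilde A_i,\tilde B_{ij},\tilde C_{ij}$. Let $\tilde{\mathcal{C}}_P$ be the conic in $\mathbb{P}^2$ with equation $\sum_{1\le i,j\le3}\tilde{\mathbf{C}}_{ij}x_ix_j=0$. Given a point in $\tilde{\mathcal{C}}_P(k)$, let $\theta:\mathbb{P}^1\to\tilde{\mathcal{C}}_P$, $(X_0,X_1)\mapsto(\vartheta_1,\vartheta_2,\vartheta_3)$, be the parametrization (by quadratic forms $\vartheta_i\in k[X_0,X_1]$) corresponding to that $k$-point. Then there is a nonzero factor $\beta$, depending on the choice of $(\vartheta_i)$, such that $$f=\frac{1}{\beta\tilde{\mathbf{c}}}\sum_{i=1}^3\tilde{\mathbf{A}}_i\,\vartheta_i,\qquad g=\frac{1}{\beta^2\tilde{\mathbf{c}}^2}\sum_{i,j=1}^3\tilde{\mathbf{B}}_{ij}\,\vartheta_i\vartheta_j$$ are forms defined over $k$ with $[f,g]=P$, i.e. they yield a model of $P$. One has the following implications: (1) If $\tilde{\mathcal{C}}_P(k)\neq\emptyset$, then there exists a model $(f,g)$ of $P$ defined over $k$. (2) If moreover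 $P$ does not belong to the locus $M_3^{\mathrm{Aut}}$, then $\tilde{\mathcal{C}}_P(k)\neq\emptyset$ if and only if there exists a model $(f,g)$ of $P$ defined over $k$.
   Context: $k$ is a field of characteristic zero with algebraic closure $\bar k$. Transvectants: for binary forms $F,G$ in $X_0,X_1$ of orders $m,n$, $$(F,G)_r=\frac{(m-r)!(n-r)!}{m!\,n!}\sum_{l=0}^r(-1)^l\binom{r}{l}\frac{\partial^rF}{\partial X_0^{r-l}\partial X_1^{l}}\,\frac{\partial^rG}{\partial X_0^{l}\partial X_1^{r-l}} .$$ Cubic maps as pairs of forms: a cubic rational map $\phi=[F_0:F_1]$ ($F_0,F_1$ cubic forms without common factor over $\bar k$) is specified by the pair $(f,g)$ with $f=\partial F_0/\partial X_0+\partial F_1/\partial X_1$ (quadratic form) and $g=X_1F_0-X_0F_1$ (quartic form). The assignment $(F_0,F_1)\mapsto(f,g)$ is a linear isomorphism, so a pair $(f,g)$ determines $(F_0,F_1)$. Basic invariants of $(f,g)$: with $H=(g,g)_2$ and $T=(g,H)_1$, $$d=(f,f)_2,\quad i=(g,g)_4,\quad j=(H,g)_4,\quad a=(g,f^2)_4,\quad b=(H,f^2)_4,\quad c=(T,f^3)_6,$$ of degrees $2,2,3,3,4,6$. Also $\tilde c=\frac16d^2i-\frac12a^2+\frac12db$. Moduli space: two cubic maps are conjugate under $\mathrm{PGL}_2(\bar k)$ (acting by $\phi\mapsto\gamma^{-1}\circ\phi\circ\gamma$) if and only if their invariants $(d,i,j,a,b,c)$ give the same point of the weighted projective space $\mathbb{P}(2,2,3,3,4,6)$;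 the coarse moduli space $M_3$ is thereby identified with the subvariety of $\mathbb{P}(2,2,3,3,4,6)$ consisting of the points $[f,g]:=[d:i:j:a:b:c](f,g)$ for pairs $(f,g)$ coming from cubic rational maps. Any $P\in M_3(k)$ has weighted projective coordinates with values in $k$. A model of $P$ is a pair $(f,g)$ (equivalently, a cubic rational map) with coefficients in $\bar k$ and $[f,g]=P$; it is defined over $k$ if its coefficients are in $k$. $M_3^{\mathrm{Aut}}$ is the locus of points of $M_3$ corresponding to maps $\phi$ for which $\mathrm{Aut}(\phi)=\{\gamma\in\mathrm{PGL}_2(\bar k):\gamma^{-1}\circ\phi\circ\gamma=\phi\}$ is nontrivial. Further invariants (with $\tilde C_{ij}=\tilde C_{ji}$, $\tilde B_{ij}=\tilde B_{ji}$): they are obtained from the quadratic covariants $\tilde u_1=f$, $\tilde u_2=(f,g)_2$, $\tilde u_3=(\tilde u_2,f)_1$ by $\tilde C_{ij}=(\tilde u_i,\tilde u_j)_2$, $\tilde A_i=(f,\tilde u_i)_2$, $\tilde B_{ij}=(g,\tilde u_i\tilde u_j)_4$, and are the following polynomials in the basic invariants: $\tilde C_{11}=d$, $\tilde C_{12}=a$, $\tilde C_{13}=0$, $\tilde C_{22}=b+\frac13id$, $\tilde C_{23}=0$, $\tilde C_{33}=\tilde c$; $\tilde A_1=d$, $\tilde A_2=a$, $\tilde A_3=0$; $\tilde B_{11}=a$, $\tilde B_{12}=b+\frac13id$, $\tilde B_{13}=0$, $\tilde B_{22}=\frac12ia+\frac13jd$, $\tilde B_{23}=-c$, $\tilde B_{33}=\frac12ab-\frac1{12}iad-\frac16jd^2$.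 *)

theory Defs
  imports "HOL-Analysis.Cartesian_Space" "HOL-Algebra.Algebraic_Closure_Type"
begin

text \<open>The infix \<open>$\<close> is reserved for vector components.\<close>

no_notation fps_nth (infixl \<open>$\<close> 75)


section \<open>Binary forms and transvectants\<close>

text \<open>
  \<open>'a bpoly\<close> is the ring of polynomials in \<open>X0\<close>, \<open>X1\<close>: \<open>X1\<close> is the outer variable and
  \<open>X0\<close> the inner one, so the coefficient of \<open>X0 ^ i * X1 ^ j\<close> in \<open>F\<close> is \<open>coeff (coeff F j) i\<close>.
\<close>

type_synonym 'a bpoly = "'a poly poly"

definition cst :: "'a::zero \<Rightarrow> 'a bpoly" where
  "cst a = [:[:a:]:]"

definition X0 :: "'a::comm_semiring_1 bpoly" where
  "X0 = [:[:0, 1:]:]"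

definition X1 :: "'a::comm_semiring_1 bpoly" where
  "X1 = [:0, 1:]"

definition D0 :: "'a::idom bpoly \<Rightarrow> 'a bpoly" where
  "D0 = map_poly pderiv"

definition D1 :: "'a::idom bpoly \<Rightarrow> 'a bpoly" where
  "D1 = pderiv"

text \<open>The zero polynomial is a form of every order.\<close>

definition is_form :: "nat \<Rightarrow> 'a::zero bpoly \<Rightarrow> bool" where
  "is_form n F \<longleftrightarrow> (\<forall>i j. Polynomial.coeff (Polynomial.coeff F j) i \<noteq> 0 \<longrightarrow> i + j = n)"

definition eval_form :: "'a::comm_semiring_1 bpoly \<Rightarrow> 'a \<Rightarrow> 'a \<Rightarrow> 'a" where
  "eval_form F x0 x1 = poly (poly F [:x1:]) x0"

text \<open>\<open>subst_form F G0 G1\<close> is \<open>F(G0, G1)\<close>.\<close>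

definition subst_form :: "'a::comm_semiring_1 bpoly \<Rightarrow> 'a bpoly \<Rightarrow> 'a bpoly \<Rightarrow> 'a bpoly" where
  "subst_form F G0 G1 = poly (map_poly (\<lambda>p. poly (map_poly cst p) G0) F) G1"

text \<open>\<open>transvectant m n r F G\<close> is \<open>(F, G)\<^sub>r\<close> for \<open>F\<close> of order \<open>m\<close> and \<open>G\<close> of order \<open>n\<close>.\<close>

definition transvectant ::
    "nat \<Rightarrow> nat \<Rightarrow> nat \<Rightarrow> 'a::field_char_0 bpoly \<Rightarrow> 'a bpoly \<Rightarrow> 'a bpoly" where
  "transvectant m n r F G =
     cst (fact (m - r) * fact (n - r) / (fact m * fact n)) *
     (\<Sum>l\<le>r. (-1) ^ l * of_nat (r choose l) *
        (D0 ^^ (r - l)) ((D1 ^^ l) F) * (D0 ^^ l) ((D1 ^^ (r - l)) G))"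


section \<open>Basic invariants and weighted projective points\<close>

text \<open>Values of the invariants, in the order \<open>(d, i, j, a, b, c)\<close>.\<close>

type_synonym 'a inv6 = "'a \<times> 'a \<times> 'a \<times> 'a \<times> 'a \<times> 'a"

text \<open>The full transvectants below are forms of order zero; \<open>const_val\<close> reads off their value.\<close>

definition const_val :: "'a::zero bpoly \<Rightarrow> 'a" where
  "const_val F = Polynomial.coeff (Polynomial.coeff F 0) 0"

definition basic_invs :: "'a::field_char_0 bpoly \<Rightarrow> 'a bpoly \<Rightarrow> 'a inv6" where
  "basic_invs f g =
    (let H = transvectant 4 4 2 g g;
         T = transvectant 4 4 1 g H
     in (const_val (transvectant 2 2 2 f f),
         const_val (transvectant 4 4 4 g g),
         const_val (transvectant 4 4 4 H g),
         const_val (transvectant 4 4 4 g (f ^ 2)),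
         const_val (transvectant 4 4 4 H (f ^ 2)),
         const_val (transvectant 6 6 6 T (f ^ 3))))"

fun wscale :: "'a::comm_semiring_1 \<Rightarrow> 'a inv6 \<Rightarrow> 'a inv6" where
  "wscale t (d, i, j, a, b, c) = (t^2 * d, t^2 * i, t^3 * j, t^3 * a, t^4 * b, t^6 * c)"

text \<open>
  \<open>wpoint v\<close> is the point \<open>[d:i:j:a:b:c]\<close> of the weighted projective space
  \<open>\<P>(2,2,3,3,4,6)\<close>, as the orbit of its coordinate vectors over an algebraically closed field.
\<close>

definition wpoint :: "'b::{field_char_0, alg_closed_field} inv6 \<Rightarrow> 'b inv6 set" where
  "wpoint v = {wscale t v | t. t \<noteq> 0}"

definition weighted_proj_space :: "'b::{field_char_0, alg_closed_field} inv6 set set" where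
  "weighted_proj_space = {wpoint v | v. v \<noteq> (0, 0, 0, 0, 0, 0)}"


section \<open>Cubic maps, their automorphisms, and the moduli space\<close>

text \<open>A rational map \<open>[F0 : F1]\<close> is represented by the pair \<open>(F0, F1)\<close>.\<close>

definition cubic_map :: "'b::field bpoly \<times> 'b bpoly \<Rightarrow> bool" where
  "cubic_map \<phi> \<longleftrightarrow> is_form 3 (fst \<phi>) \<and> is_form 3 (snd \<phi>) \<and> coprime (fst \<phi>) (snd \<phi>)"

definition quadratic_part :: "'b::field bpoly \<times> 'b bpoly \<Rightarrow> 'b bpoly" where
  "quadratic_part \<phi> = D0 (fst \<phi>) + D1 (snd \<phi>)"

definition quartic_part :: "'b::field bpoly \<times> 'b bpoly \<Rightarrow> 'b bpoly" where
  "quartic_part \<phi> = X1 * fst \<phi> - X0 * snd \<phi>"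

definition moduli_point ::
    "'b::{field_char_0, alg_closed_field} bpoly \<Rightarrow> 'b bpoly \<Rightarrow> 'b inv6 set" where
  "moduli_point f g = wpoint (basic_invs f g)"

definition M3 :: "'b::{field_char_0, alg_closed_field} inv6 set set" where
  "M3 = {P \<in> weighted_proj_space.
           \<exists>\<phi>. cubic_map \<phi> \<and> P = moduli_point (quadratic_part \<phi>) (quartic_part \<phi>)}"

definition same_map :: "'b::field bpoly \<times> 'b bpoly \<Rightarrow> 'b bpoly \<times> 'b bpoly \<Rightarrow> bool" where
  "same_map \<phi> \<psi> \<longleftrightarrow> (\<exists>t. t \<noteq> 0 \<and> fst \<psi> = cst t * fst \<phi> \<and> snd \<psi> = cst t * snd \<phi>)"

text \<open>The pair representing \<open>\<gamma>\<inverse> \<circ> \<phi> \<circ> \<gamma>\<close>, for an invertible matrix \<open>\<gamma>\<close>.\<close>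

definition conj_map :: "'b::field ^ 2 ^ 2 \<Rightarrow> 'b bpoly \<times> 'b bpoly \<Rightarrow> 'b bpoly \<times> 'b bpoly" where
  "conj_map \<gamma> \<phi> =
    (let Y0 = cst (\<gamma> $ 1 $ 1) * X0 + cst (\<gamma> $ 1 $ 2) * X1;
         Y1 = cst (\<gamma> $ 2 $ 1) * X0 + cst (\<gamma> $ 2 $ 2) * X1;
         G0 = subst_form (fst \<phi>) Y0 Y1;
         G1 = subst_form (snd \<phi>) Y0 Y1;
         N = matrix_inv \<gamma>
     in (cst (N $ 1 $ 1) * G0 + cst (N $ 1 $ 2) * G1,
         cst (N $ 2 $ 1) * G0 + cst (N $ 2 $ 2) * G1))"

text \<open>
  The preimage of \<open>Aut(\<phi>) \<subseteq> PGL\<^sub>2\<close> in \<open>GL\<^sub>2\<close>; hence \<open>Aut(\<phi>)\<close> is trivial iff all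
  elements of \<open>Aut_GL \<phi>\<close> are scalar matrices \<open>mat t\<close>.
\<close>

definition Aut_GL :: "'b::field bpoly \<times> 'b bpoly \<Rightarrow> ('b ^ 2 ^ 2) set" where
  "Aut_GL \<phi> = {\<gamma>. invertible \<gamma> \<and> same_map \<phi> (conj_map \<gamma> \<phi>)}"

definition M3_Aut :: "'b::{field_char_0, alg_closed_field} inv6 set set" where
  "M3_Aut = {P \<in> M3.
     \<exists>\<phi>. cubic_map \<phi> \<and> P = moduli_point (quadratic_part \<phi>) (quartic_part \<phi>) \<and>
         (\<exists>\<gamma> \<in> Aut_GL \<phi>. \<forall>t. \<gamma> \<noteq> mat t)}"

definition is_model ::
    "'b::{field_char_0, alg_closed_field} inv6 set \<Rightarrow> 'b bpoly \<Rightarrow> 'b bpoly \<Rightarrow> bool" where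
  "is_model P f g \<longleftrightarrow>
     (\<exists>\<phi>. cubic_map \<phi> \<and> f = quadratic_part \<phi> \<and> g = quartic_part \<phi>) \<and> moduli_point f g = P"


section \<open>The base field inside its algebraic closure\<close>

definition lift_form :: "'a::field bpoly \<Rightarrow> 'a alg_closure bpoly" where
  "lift_form = map_poly (map_poly to_ac)"

fun lift_inv :: "'a::field inv6 \<Rightarrow> 'a alg_closure inv6" where
  "lift_inv (d, i, j, a, b, c) = (to_ac d, to_ac i, to_ac j, to_ac a, to_ac b, to_ac c)"

definition is_model_over_base ::
    "'a::field_char_0 alg_closure inv6 set \<Rightarrow> 'a bpoly \<Rightarrow> 'a bpoly \<Rightarrow> bool" where
  "is_model_over_base P f g \<longleftrightarrow>
     is_form 2 f \<and> is_form 4 g \<and> is_model P (lift_form f) (lift_form g)"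


section \<open>Further invariants\<close>

text \<open>
  With \<open>u\<^sub>1 = f\<close>, \<open>u\<^sub>2 = (f, g)\<^sub>2\<close>, \<open>u\<^sub>3 = (u\<^sub>2, f)\<^sub>1\<close>, the following are the expressions of
  \<open>(u\<^sub>i, u\<^sub>j)\<^sub>2\<close>, \<open>(f, u\<^sub>i)\<^sub>2\<close> and \<open>(g, u\<^sub>i u\<^sub>j)\<^sub>4\<close> in the basic invariants. The index type \<open>3\<close>
  consists of \<open>1\<close>, \<open>2\<close>, \<open>3\<close> (where \<open>3 = 0\<close>), and \<open>vector\<close> lists the entries in the order 1, 2, 3.
\<close>

fun c_tilde :: "'a::field_char_0 inv6 \<Rightarrow> 'a" where
  "c_tilde (d, i, j, a, b, c) = 1/6 * d^2 * i - 1/2 * a^2 + 1/2 * d * b"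

fun C_tilde :: "'a::field_char_0 inv6 \<Rightarrow> 'a ^ 3 ^ 3" where
  "C_tilde (d, i, j, a, b, c) = vector
     [vector [d, a, 0],
      vector [a, b + 1/3 * i * d, 0],
      vector [0, 0, c_tilde (d, i, j, a, b, c)]]"

fun A_tilde :: "'a::field_char_0 inv6 \<Rightarrow> 'a ^ 3" where
  "A_tilde (d, i, j, a, b, c) = vector [d, a, 0]"

fun B_tilde :: "'a::field_char_0 inv6 \<Rightarrow> 'a ^ 3 ^ 3" where
  "B_tilde (d, i, j, a, b, c) = vector
     [vector [a, b + 1/3 * i * d, 0],
      vector [b + 1/3 * i * d, 1/2 * i * a + 1/3 * j * d, - c],
      vector [0, - c, 1/2 * a * b - 1/12 * i * a * d - 1/6 * j * d^2]]"


section \<open>Plane conics and their parametrizations\<close>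

text \<open>The homogeneous coordinate vectors of the \<open>k\<close>-points of the conic \<open>\<Sum> C\<^sub>i\<^sub>j x\<^sub>i x\<^sub>j = 0\<close>.\<close>

definition conic_points :: "'a::field ^ 3 ^ 3 \<Rightarrow> ('a ^ 3) set" where
  "conic_points C = {x. x \<noteq> 0 \<and> (\<Sum>i\<in>UNIV. \<Sum>j\<in>UNIV. C $ i $ j * x $ i * x $ j) = 0}"

text \<open>
  \<open>conic_param C Q \<theta>\<close>: the quadratic forms \<open>\<theta>\<^sub>1, \<theta>\<^sub>2, \<theta>\<^sub>3\<close> over \<open>k\<close> define a morphism from
  \<open>\<P>\<^sup>1\<close> to the conic (no common zero over the algebraic closure, equation satisfied identically)
  which is inverse to the projection from the point \<open>Q\<close>. The pencil of lines through \<open>Q\<close> is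
  coordinatized by two linear forms \<open>m\<close>, \<open>n\<close> over \<open>k\<close> whose only common zero is \<open>Q\<close>; the
  projection is \<open>x \<mapsto> [m(x) : n(x)]\<close>, and being its inverse means
  \<open>[m(\<theta>) : n(\<theta>)] = [X0 : X1]\<close>. The choice of \<open>m\<close>, \<open>n\<close> amounts to a choice of coordinate on
  \<open>\<P>\<^sup>1\<close> over \<open>k\<close>.
\<close>

definition conic_param :: "'a::field ^ 3 ^ 3 \<Rightarrow> 'a ^ 3 \<Rightarrow> 'a bpoly ^ 3 \<Rightarrow> bool" where
  "conic_param C Q \<theta> \<longleftrightarrow>
     (\<forall>i. is_form 2 (\<theta> $ i)) \<and>
     (\<forall>x0 x1. (x0, x1) \<noteq> (0, 0) \<longrightarrow> (\<exists>i. eval_form (lift_form (\<theta> $ i)) x0 x1 \<noteq> 0)) \<and>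
     (\<Sum>i\<in>UNIV. \<Sum>j\<in>UNIV. cst (C $ i $ j) * \<theta> $ i * \<theta> $ j) = 0 \<and>
     (\<exists>m n :: 'a ^ 3.
        (\<forall>x :: 'a ^ 3. (\<Sum>i\<in>UNIV. m $ i * x $ i) = 0 \<and> (\<Sum>i\<in>UNIV. n $ i * x $ i) = 0
               \<longleftrightarrow> (\<exists>t. x = t *s Q)) \<and>
        X1 * (\<Sum>i\<in>UNIV. cst (m $ i) * \<theta> $ i) = X0 * (\<Sum>i\<in>UNIV. cst (n $ i) * \<theta> $ i))"

end

theory Submission
  imports Defs "HOL-Analysis.Determinants"
begin

text \<open>
  The second transvectant \<open>(u, w)\<^sub>2\<close> is a nondegenerate symmetric bilinear form on the
  three-dimensional space of binary quadratic forms. Write \<open>C\<close> for the matrix \<open>C_tilde v\<close> and \<open>c\<close>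
  for \<open>c_tilde v\<close>. For a pair \<open>(f, g)\<close> with invariants \<open>v\<close>, the covariants \<open>u\<^sub>1 = f\<close>,
  \<open>u\<^sub>2 = (f, g)\<^sub>2\<close>, \<open>u\<^sub>3 = (u\<^sub>2, f)\<^sub>1\<close> have Gram matrix \<open>C\<close>, which has determinant \<open>2 c\<^sup>2\<close>, and
  coefficient determinant \<open>- c\<close> (\<open>gram_covariants\<close>). If \<open>c \<noteq> 0\<close> they form a basis, and in terms of
  the dual basis \<open>u\<^sup>i\<close> one has \<open>f = \<Sum> A\<^sub>i u\<^sup>i\<close> and \<open>g = \<Sum> B\<^sub>i\<^sub>j u\<^sup>i u\<^sup>j\<close>
  (\<open>covariant_dual_basis\<close>). So \<open>v\<close> and the dual basis determine \<open>(f, g)\<close>, and \<open>v\<close> alone determines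
  the Gram matrix \<open>C\<^sup>-\<^sup>1\<close> and the coefficient determinant of the dual basis.

  Over an algebraically closed field every linear map that preserves \<open>(u, w)\<^sub>2\<close> and has determinant 1
  is induced by a substitution of determinant 1 (\<open>special_orthogonal_is_sym2\<close>). Hence any triple of
  quadratic forms with that Gram matrix and that determinant gives, by the same two sums, a pair
  \<open>(f \<circ> \<gamma>, g \<circ> \<gamma>)\<close>, which is the pair of the conjugate map \<open>\<gamma>\<^sup>-\<^sup>1 \<circ> \<phi> \<circ> \<gamma>\<close>
  (\<open>twist_of_dual_basis\<close>).

  A triple of quadratic forms has Gram matrix \<open>C\<^sup>-\<^sup>1\<close> exactly when its coefficient matrix \<open>W\<close>
  satisfies \<open>W\<^sup>T C W = D\<^sup>-\<^sup>1\<close>, where \<open>D\<close> is the matrix of \<open>(u, w)\<^sub>2\<close>. That the triple lies on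
  the conic says the same up to a factor \<open>\<mu>\<close>. For a parametrization \<open>\<theta>\<close> over \<open>k\<close> the factor
  \<open>\<mu>\<close> lies in \<open>k\<close> and is not zero. Comparing determinants shows that \<open>\<mu> = \<kappa>\<^sup>2\<close> with
  \<open>\<kappa> \<in> k\<close>, because \<open>det C\<close> is twice a square, and the sign of \<open>\<kappa>\<close> can be chosen so
  that \<open>\<theta> / \<kappa>\<close> also has the determinant of the dual basis (\<open>conic_param_dual_basis\<close>). This gives
  the model over \<open>k\<close>, with \<open>\<beta> = \<kappa> / c\<close>.

  Conversely, a model over \<open>k\<close> has invariants \<open>t \<cdot> v\<close> for some \<open>t\<close> in the algebraic closure. If
  \<open>t \<in> k\<close>, then the model divided by \<open>t\<close> has invariants \<open>v\<close>, and its dual basis evaluated at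
  \<open>(1, 0)\<close> is a \<open>k\<close>-point of the conic. If \<open>d = 0\<close>, the conic contains \<open>[1 : 0 : 0]\<close>. If
  \<open>d \<noteq> 0\<close>, then \<open>t\<^sup>2 \<in> k\<close>; when \<open>a\<close> or \<open>j\<close> is not zero also \<open>t\<^sup>3 \<in> k\<close>, so \<open>t \<in> k\<close>. In
  the remaining case \<open>a = j = 0\<close> the pairs \<open>(f, g)\<close> and \<open>(- f, - g)\<close> have the same invariants, so a
  substitution maps one to the other; it is a nontrivial automorphism of the map
  (\<open>aut_of_odd_invariants_zero\<close>), which is excluded.
\<close>

section \<open>Homomorphisms and derivations of the ring of bivariate polynomials\<close>

text \<open>
  The operations on bivariate polynomials used below (constants, substitution, evaluation, change of
  the coefficient field, value at the origin) are all ring homomorphisms. This predicate gives them one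
  common list of rewrite rules.
\<close>
definition is_hom :: "('a::comm_ring_1 \<Rightarrow> 'b::comm_ring_1) \<Rightarrow> bool" where
  "is_hom h \<longleftrightarrow> h 0 = 0 \<and> h 1 = 1 \<and> (\<forall>x y. h (x + y) = h x + h y) \<and> (\<forall>x y. h (x * y) = h x * h y)"

lemma is_hom_simps:
  assumes "is_hom h"
  shows "h 0 = 0" "h 1 = 1" "h (x + y) = h x + h y" "h (x * y) = h x * h y"
    "h (- x) = - h x" "h (x - y) = h x - h y" "h (x ^ n) = h x ^ n"
    "h (of_nat n) = of_nat n" "h (numeral m) = numeral m" "h (\<Sum>i\<in>I. f i) = (\<Sum>i\<in>I. h (f i))"
proof -
  show 1: "h 0 = 0" "h 1 = 1" and 2: "h (x + y) = h x + h y" "h (x * y) = h x * h y" for x y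
    using assms by (auto simp: is_hom_def)
  show 3: "h (- x) = - h x" for x
    using 1 2(1)[of x "- x"] by (simp add: eq_neg_iff_add_eq_0 add.commute)
  show "h (x - y) = h x - h y"
    using 2(1)[of x "- y"] 3 by simp
  show "h (x ^ n) = h x ^ n"
    by (induction n) (auto simp: 1 2)
  show 4: "h (of_nat n) = of_nat n" for n
    by (induction n) (auto simp: 1 2)
  show "h (numeral m) = numeral m"
    using 4[of "numeral m"] by simp
  show "h (\<Sum>i\<in>I. f i) = (\<Sum>i\<in>I. h (f i))"
    by (induction I rule: infinite_finite_induct) (auto simp: 1 2)
qed

lemma is_hom_comp: "is_hom g \<Longrightarrow> is_hom h \<Longrightarrow> is_hom (\<lambda>x. g (h x))"
  by (simp add: is_hom_def)

lemma is_hom_map_poly: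
  assumes "is_hom h"
  shows "is_hom (map_poly h)"
  unfolding is_hom_def
proof (intro conjI allI)
  note h = is_hom_simps[OF assms]
  show "map_poly h 0 = 0" by simp
  show "map_poly h 1 = 1" by (simp add: h)
  show "map_poly h (p + q) = map_poly h p + map_poly h q" for p q
    by (rule poly_eqI) (simp add: coeff_map_poly h)
  show "map_poly h (p * q) = map_poly h p * map_poly h q" for p q
    by (rule poly_eqI) (simp add: coeff_map_poly h coeff_mult)
qed

lemma is_hom_poly: "is_hom (\<lambda>p. poly p x)"
  by (simp add: is_hom_def)

lemma is_hom_to_ac: "is_hom to_ac"
  by (simp add: is_hom_def)

lemma is_hom_lift_form: "is_hom lift_form"
  unfolding lift_form_def by (intro is_hom_map_poly is_hom_to_ac)

lemma is_hom_cst: "is_hom (cst :: 'a::comm_ring_1 \<Rightarrow> _)"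
  by (simp add: is_hom_def cst_def one_pCons)

lemma is_hom_eval_form: "is_hom (\<lambda>F. eval_form F x0 x1)"
  by (simp add: is_hom_def eval_form_def)

lemma is_hom_const_val: "is_hom const_val"
  by (simp add: is_hom_def const_val_def coeff_mult)

lemma is_hom_subst_form: "is_hom (\<lambda>F. subst_form F (G0 :: 'a::comm_ring_1 bpoly) G1)"
proof -
  have "is_hom (\<lambda>p. poly (map_poly (cst :: 'a \<Rightarrow> _) p) G0)"
    by (rule is_hom_comp[OF is_hom_poly is_hom_map_poly[OF is_hom_cst]])
  then show ?thesis
    unfolding subst_form_def by (rule is_hom_comp[OF is_hom_poly is_hom_map_poly])
qed

lemmas hom_cst = is_hom_simps[OF is_hom_cst]
lemmas hom_lift = is_hom_simps[OF is_hom_lift_form]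
lemmas hom_eval = is_hom_simps[OF is_hom_eval_form]
lemmas hom_subst = is_hom_simps[OF is_hom_subst_form]
lemmas hom_const_val = is_hom_simps[OF is_hom_const_val]

lemma generators_lift: "lift_form (cst a) = cst (to_ac a)" "lift_form X0 = X0" "lift_form X1 = X1"
  by (simp_all add: lift_form_def cst_def X0_def X1_def map_poly_pCons)

lemma generators_eval: "eval_form (cst a) x0 x1 = a" "eval_form X0 x0 x1 = x0" "eval_form X1 x0 x1 = x1"
  by (simp_all add: eval_form_def cst_def X0_def X1_def)

lemma generators_subst:
  fixes G0 G1 :: "'a::comm_ring_1 bpoly"
  shows "subst_form (cst a) G0 G1 = cst a" "subst_form X0 G0 G1 = G0" "subst_form X1 G0 G1 = G1"
  by (simp_all add: subst_form_def cst_def X0_def X1_def map_poly_pCons one_pCons)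
     (simp_all add: one_pCons[symmetric])

lemma D0_add [simp]: "D0 (F + G) = D0 F + D0 G"
  unfolding D0_def by (rule poly_eqI) (simp add: coeff_map_poly pderiv_add)

lemma D1_add [simp]: "D1 (F + G) = D1 F + D1 G"
  by (simp add: D1_def pderiv_add)

lemma pderiv_sum': "pderiv (\<Sum>i\<in>I. f i) = (\<Sum>i\<in>I. pderiv (f i))"
  by (induction I rule: infinite_finite_induct) (simp_all add: pderiv_add)

lemma D0_mult [simp]: "D0 (F * G) = F * D0 G + D0 F * G"
  unfolding D0_def
  by (rule poly_eqI, simp add: coeff_map_poly coeff_mult pderiv_sum' pderiv_mult sum.distrib)
     (simp add: mult.commute)

lemma D1_mult [simp]: "D1 (F * G) = F * D1 G + D1 F * G"
  by (simp add: D1_def pderiv_mult mult.commute)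

lemma D_gens [simp]: "D0 (cst a) = 0" "D0 X0 = 1" "D0 X1 = 0" "D1 (cst a) = 0" "D1 X0 = 0" "D1 X1 = 1"
  "D0 0 = 0" "D1 0 = 0" "D0 1 = 0" "D1 1 = 0"
  by (simp_all add: D0_def D1_def cst_def X0_def X1_def map_poly_pCons pderiv_pCons one_pCons)

lemma D_minus [simp]: "D0 (- F) = - D0 F" "D1 (- F) = - D1 F"
  using D0_add[of F "- F"] D1_add[of F "- F"] by (simp_all add: eq_neg_iff_add_eq_0 add.commute)

lemma D_diff [simp]: "D0 (F - G) = D0 F - D0 G" "D1 (F - G) = D1 F - D1 G"
  using D0_add[of F "- G"] D1_add[of F "- G"] by simp_all

lemma D_numeral [simp]: "D0 (numeral n) = 0" "D1 (numeral n) = 0"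
  using D_gens(1)[of "numeral n"] D_gens(4)[of "numeral n"] by (simp_all add: hom_cst del: D_gens)

lemma D_power [simp]: "D0 (F ^ Suc n) = of_nat (Suc n) * F ^ n * D0 F" "D1 (F ^ Suc n) = of_nat (Suc n) * F ^ n * D1 F"
  by (induction n) (simp_all add: algebra_simps)

section \<open>Forms and their coefficients\<close>

definition form_coeff :: "'a::zero bpoly \<Rightarrow> nat \<Rightarrow> nat \<Rightarrow> 'a" where
  "form_coeff F i j = Polynomial.coeff (Polynomial.coeff F j) i"

lemma bpoly_eqI: "(\<And>i j. form_coeff F i j = form_coeff G i j) \<Longrightarrow> F = G"
  unfolding form_coeff_def by (intro poly_eqI) auto

lemma form_coeff_linear:
  "form_coeff 0 i j = 0" "form_coeff (F + G) i j = form_coeff F i j + form_coeff G i j" "form_coeff (F - G) i j = form_coeff F i j - form_coeff G i j"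
  "form_coeff (- F) i j = - form_coeff F i j" "form_coeff (cst a * F) i j = a * form_coeff F i j" "form_coeff (\<Sum>l\<in>I. f l) i j = (\<Sum>l\<in>I. form_coeff (f l) i j)"
  for F :: "'a::comm_ring_1 bpoly"
  by (simp_all add: form_coeff_def cst_def Polynomial.coeff_sum)

lemma monomial_eq: "X0 ^ m * X1 ^ n = Polynomial.monom (Polynomial.monom (1 :: 'a::comm_ring_1) m) n"
proof -
  have "(X0 :: 'a bpoly) ^ m = [:Polynomial.monom 1 m:]"
    by (induction m) (simp_all add: X0_def one_pCons monom_Suc)
  moreover have "(X1 :: 'a bpoly) ^ n = Polynomial.monom 1 n"
    by (induction n) (simp_all add: X1_def one_pCons[symmetric] monom_Suc)
  ultimately show ?thesis
    by (simp add: smult_monom)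
qed

lemma form_coeff_monomial: "form_coeff (X0 ^ m * X1 ^ n) i j = (if i = m \<and> j = n then 1 else (0 :: 'a::comm_ring_1))"
  by (simp add: monomial_eq form_coeff_def)

text \<open>
  Homomorphic images of a form, and its products with other forms, are computed from this expansion.
\<close>
lemma form_expansion:
  fixes F :: "'a::comm_ring_1 bpoly"
  assumes "is_form n F"
  shows "F = (\<Sum>j\<le>n. cst (form_coeff F (n - j) j) * (X0 ^ (n - j) * X1 ^ j))"
proof (rule bpoly_eqI)
  fix i j
  have "form_coeff (\<Sum>l\<le>n. cst (form_coeff F (n - l) l) * (X0 ^ (n - l) * X1 ^ l)) i j =
      (\<Sum>l\<le>n. if l = j then (if i = n - j then form_coeff F (n - j) j else 0) else 0)"
    unfolding form_coeff_linear form_coeff_monomial by (rule sum.cong) auto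
  also have "\<dots> = (if j \<le> n \<and> i = n - j then form_coeff F (n - j) j else 0)"
    by simp
  also have "\<dots> = form_coeff F i j"
    using assms unfolding is_form_def form_coeff_def by fastforce
  finally show "form_coeff F i j = form_coeff (\<Sum>j\<le>n. cst (form_coeff F (n - j) j) * (X0 ^ (n - j) * X1 ^ j)) i j" ..
qed

lemma is_form_0: "is_form n 0"
  by (simp add: is_form_def)

lemma is_form_add: "is_form n F \<Longrightarrow> is_form n G \<Longrightarrow> is_form n (F + G)" for F :: "'a::comm_ring_1 bpoly"
  unfolding is_form_def by (metis Polynomial.coeff_add add.right_neutral)

lemma is_form_uminus: "is_form n F \<Longrightarrow> is_form n (- F)" for F :: "'a::comm_ring_1 bpoly"
  unfolding is_form_def by simp

lemma is_form_diff: "is_form n F \<Longrightarrow> is_form n G \<Longrightarrow> is_form n (F - G)" for F :: "'a::comm_ring_1 bpoly"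
  using is_form_add[of n F "- G"] is_form_uminus[of n G] by simp

lemma is_form_sum: "(\<And>l. l \<in> I \<Longrightarrow> is_form n (f l)) \<Longrightarrow> is_form n (\<Sum>l\<in>I. f l :: 'a::comm_ring_1 bpoly)"
  by (induction I rule: infinite_finite_induct) (simp_all add: is_form_0 is_form_add)

lemma is_form_cst_mult: "is_form n F \<Longrightarrow> is_form n (cst a * F)" for F :: "'a::comm_ring_1 bpoly"
  unfolding is_form_def cst_def by simp (metis mult_zero_right)

lemma is_form_monomial: "is_form (m + n) (X0 ^ m * X1 ^ n :: 'a::comm_ring_1 bpoly)"
  using form_coeff_monomial[where 'a = 'a] unfolding is_form_def form_coeff_def by metis

lemma is_form_mult:
  fixes F G :: "'a::comm_ring_1 bpoly"
  assumes "is_form m F" "is_form n G"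
  shows "is_form (m + n) (F * G)"
proof -
  have "F * G = (\<Sum>i\<le>m. \<Sum>j\<le>n. cst (form_coeff F (m - i) i * form_coeff G (n - j) j) * (X0 ^ ((m - i) + (n - j)) * X1 ^ (i + j)))"
    by (subst form_expansion[OF assms(1)], subst form_expansion[OF assms(2)], simp only: sum_product hom_cst power_add mult_ac)
  moreover have "is_form (m + n) (X0 ^ ((m - i) + (n - j)) * X1 ^ (i + j) :: 'a bpoly)" if "i \<le> m" "j \<le> n" for i j
    using is_form_monomial[of "(m - i) + (n - j)" "i + j"] that by (simp add: algebra_simps)
  ultimately show ?thesis
    by (auto intro!: is_form_sum is_form_cst_mult)
qed

lemma is_form_power: "is_form m F \<Longrightarrow> is_form (n * m) (F ^ n)" for F :: "'a::comm_ring_1 bpoly"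
proof (induction n)
  case 0
  then show ?case using is_form_monomial[of 0 0] by simp
qed (simp add: is_form_mult)

lemma is_form_X: "is_form 1 (X0 :: 'a::comm_ring_1 bpoly)" "is_form 1 (X1 :: 'a::comm_ring_1 bpoly)"
  using is_form_monomial[of 1 0, where 'a = 'a] is_form_monomial[of 0 1, where 'a = 'a] by simp_all

lemma form_coeff_D: "form_coeff (D0 F) i j = of_nat (Suc i) * form_coeff F (Suc i) j" "form_coeff (D1 F) i j = of_nat (Suc j) * form_coeff F i (Suc j)"
  for F :: "'a::field_char_0 bpoly"
proof -
  show "form_coeff (D0 F) i j = of_nat (Suc i) * form_coeff F (Suc i) j"
    by (simp add: form_coeff_def D0_def coeff_map_poly coeff_pderiv)
  have "form_coeff (of_nat n * F) i j = of_nat n * form_coeff F i j" for n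
    using form_coeff_linear(5)[of "of_nat n" F i j] by (simp add: hom_cst)
  moreover have "Polynomial.coeff (of_nat n * G) i = of_nat n * Polynomial.coeff G i" for n and G :: "'a poly"
    by (metis of_nat_poly coeff_smult mult.commute mult_smult_right mult_1_right smult_conv_map_poly smult_one)
  ultimately show "form_coeff (D1 F) i j = of_nat (Suc j) * form_coeff F i (Suc j)"
    by (simp add: form_coeff_def D1_def coeff_pderiv del: of_nat_Suc)
qed

text \<open>
  Taylor's formula at the origin. It turns a full transvectant, which is a sum of products of iterated
  derivatives, into a sum of products of coefficients.
\<close>
lemma const_val_D: "const_val ((D0 ^^ m) ((D1 ^^ n) F)) = fact m * fact n * form_coeff F m n"
  for F :: "'a::field_char_0 bpoly"
proof -
  have 1: "fact j * form_coeff ((D1 ^^ n) F) i j = fact (j + n) * form_coeff F i (j + n)" for i j n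
  proof (induction n arbitrary: j)
    case (Suc n)
    then show ?case
      using Suc[of "Suc j"] by (simp add: form_coeff_D algebra_simps)
  qed simp
  have 2: "fact i * form_coeff ((D0 ^^ m) G) i j = fact (i + m) * form_coeff G (i + m) j" for i j m and G :: "'a bpoly"
  proof (induction m arbitrary: i)
    case (Suc m)
    then show ?case
      using Suc[of "Suc i"] by (simp add: form_coeff_D algebra_simps)
  qed simp
  show ?thesis
    using 1[of 0 n m] 2[of 0 m "(D1 ^^ n) F" 0] by (simp add: const_val_def form_coeff_def)
qed

lemma const_val_full_transvectant:
  "const_val (transvectant n n n F G) = (\<Sum>l\<le>n. (-1) ^ l * form_coeff F (n - l) l * form_coeff G l (n - l) / of_nat (n choose l))"
proof -
  have "const_val (transvectant n n n F G) =
      (\<Sum>l\<le>n. 1 / (fact n * fact n) * ((-1) ^ l * of_nat (n choose l) * (fact (n - l) * fact l * form_coeff F (n - l) l) * (fact l * fact (n - l) * form_coeff G l (n - l))))"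
    by (simp add: transvectant_def hom_const_val const_val_D sum_distrib_left) (simp add: const_val_def cst_def)
  also have "\<dots> = (\<Sum>l\<le>n. (-1) ^ l * form_coeff F (n - l) l * form_coeff G l (n - l) / of_nat (n choose l))"
    by (rule sum.cong) (simp_all add: binomial_fact field_simps)
  finally show ?thesis .
qed

section \<open>Transvectants in coordinates\<close>

text \<open>
  The forms of order \<open>n\<close> are given by lists of length \<open>n + 1\<close>. With literal lists the simplifier
  evaluates coefficients of forms of orders 2, 4 and 6.
\<close>
definition form_of_list :: "'a::comm_ring_1 list \<Rightarrow> 'a bpoly" where
  "form_of_list as = (\<Sum>j<length as. cst (as ! j) * (X0 ^ (length as - Suc j) * X1 ^ j))"

lemma form_coeff_of_list: "form_coeff (form_of_list as) i j = (if Suc (i + j) = length as then as ! j else 0)"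
proof -
  have "form_coeff (form_of_list as) i j = (\<Sum>l<length as. if l = j then (if i = length as - Suc j then as ! j else 0) else 0)"
    unfolding form_of_list_def form_coeff_linear form_coeff_monomial by (rule sum.cong) auto
  also have "\<dots> = (if j < length as \<and> i = length as - Suc j then as ! j else 0)"
    by simp
  also have "\<dots> = (if Suc (i + j) = length as then as ! j else 0)"
    by auto
  finally show ?thesis .
qed

text \<open>
  The middle coefficient is twice the vector entry, and the quartic coefficients carry binomial
  factors. In these classical coordinates transvectants have the simplest coefficients.
\<close>
definition quadratic :: "'a::comm_ring_1 ^ 3 \<Rightarrow> 'a bpoly" where
  "quadratic u = form_of_list [u $ 1, 2 * u $ 2, u $ 3]"

definition quartic :: "'a::comm_ring_1 \<Rightarrow> 'a \<Rightarrow> 'a \<Rightarrow> 'a \<Rightarrow> 'a \<Rightarrow> 'a bpoly" where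
  "quartic g0 g1 g2 g3 g4 = form_of_list [g0, 4 * g1, 6 * g2, 4 * g3, g4]"

lemma quadratic_eq: "quadratic u = cst (u $ 1) * X0\<^sup>2 + 2 * cst (u $ 2) * X0 * X1 + cst (u $ 3) * X1\<^sup>2"
  by (simp add: quadratic_def form_of_list_def hom_cst mult.assoc power2_eq_square)

lemma quartic_eq: "quartic g0 g1 g2 g3 g4 = cst g0 * X0 ^ 4 + 4 * cst g1 * X0 ^ 3 * X1 + 6 * cst g2 * X0\<^sup>2 * X1\<^sup>2
     + 4 * cst g3 * X0 * X1 ^ 3 + cst g4 * X1 ^ 4"
  by (simp add: quartic_def form_of_list_def hom_cst mult.assoc numeral_eq_Suc)

lemma sextic_eq: "form_of_list [t0, t1, t2, t3, t4, t5, t6] = cst t0 * X0 ^ 6 + cst t1 * X0 ^ 5 * X1 + cst t2 * X0 ^ 4 * X1\<^sup>2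
     + cst t3 * X0 ^ 3 * X1 ^ 3 + cst t4 * X0\<^sup>2 * X1 ^ 4 + cst t5 * X0 * X1 ^ 5 + cst t6 * X1 ^ 6"
  by (simp add: form_of_list_def hom_cst mult.assoc numeral_eq_Suc)

lemma is_form_of_list: "length as = Suc n \<Longrightarrow> is_form n (form_of_list as)"
  using form_coeff_of_list[of as] by (auto simp: is_form_def form_coeff_def[symmetric] split: if_splits)

lemma form_of_list_cases:
  assumes "is_form n F"
  shows "F = form_of_list (map (\<lambda>j. form_coeff F (n - j) j) [0..<Suc n])"
proof (rule bpoly_eqI)
  fix i j show "form_coeff F i j = form_coeff (form_of_list (map (\<lambda>j. form_coeff F (n - j) j) [0..<Suc n])) i j"
    using assms by (auto simp: form_coeff_of_list is_form_def form_coeff_def[symmetric] simp del: upt_Suc)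
qed

lemma is_form_quadratic: "is_form 2 (quadratic u)"
  unfolding quadratic_def by (rule is_form_of_list) simp

lemma quadratic_form_cases:
  fixes F :: "'a::field_char_0 bpoly"
  assumes "is_form 2 F"
  obtains u where "F = quadratic u"
proof -
  have "F = quadratic (vector [form_coeff F 2 0, form_coeff F 1 1 / 2, form_coeff F 0 2])"
    by (subst form_of_list_cases[OF assms]) (simp add: quadratic_def upt_rec numeral_2_eq_2)
  then show ?thesis by (rule that)
qed

lemma quartic_form_cases:
  fixes F :: "'a::field_char_0 bpoly"
  assumes "is_form 4 F"
  obtains g0 g1 g2 g3 g4 where "F = quartic g0 g1 g2 g3 g4"
proof -
  have "F = quartic (form_coeff F 4 0) (form_coeff F 3 1 / 4) (form_coeff F 2 2 / 6) (form_coeff F 1 3 / 4) (form_coeff F 0 4)"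
    by (subst form_of_list_cases[OF assms]) (simp add: quartic_def upt_rec numeral_eq_Suc)
  then show ?thesis by (rule that)
qed

lemma binomials: "(4::nat) choose 2 = 6" "(6::nat) choose 2 = 15" "(6::nat) choose 3 = 20" "(6::nat) choose 4 = 15"
  "(6::nat) choose 5 = 6" "(4::nat) choose 3 = 4"
  by (simp_all add: numeral_eq_Suc)

lemma full_transvectant_quadratic:
  "const_val (transvectant 2 2 2 (quadratic u) (quadratic w)) = u $ 1 * w $ 3 - 2 * u $ 2 * w $ 2 + u $ 3 * w $ 1"
  by (simp add: const_val_full_transvectant quadratic_def form_coeff_of_list numeral_2_eq_2 atMost_Suc)

lemma full_transvectant_quartic:
  "const_val (transvectant 4 4 4 (quartic g0 g1 g2 g3 g4) (quartic h0 h1 h2 h3 h4))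
     = g0 * h4 - 4 * g1 * h3 + 6 * g2 * h2 - 4 * g3 * h1 + g4 * h0"
proof -
  have "{..4::nat} = {0,1,2,3,4}" by auto
  then show ?thesis by (simp add: const_val_full_transvectant quartic_def form_coeff_of_list binomials)
qed

lemma full_transvectant_sextic:
  "const_val (transvectant 6 6 6 (form_of_list [t0, t1, t2, t3, t4, t5, t6]) (form_of_list [s0, s1, s2, s3, s4, s5, s6]))
     = t0 * s6 - t1 * s5 / 6 + t2 * s4 / 15 - t3 * s3 / 20 + t4 * s2 / 15 - t5 * s1 / 6 + t6 * s0"
proof -
  have "{..6::nat} = {0,1,2,3,4,5,6}" by auto
  then show ?thesis by (simp add: const_val_full_transvectant form_coeff_of_list binomials)
qed

lemma numeral_bpoly_cst: "(numeral n :: 'a::comm_ring_1 bpoly) = cst (numeral n)"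
  by (simp add: hom_cst)

text \<open>
  The covariant \<open>H\<close>. The constant \<open>1 / 144\<close> is the normalizing factor \<open>(2! 2!) / (4! 4!)\<close>; the sum of
  products of second derivatives is 144 times the right-hand side.
\<close>
lemma hessian_quartic:
  "transvectant 4 4 2 (quartic g0 g1 g2 g3 g4) (quartic g0 g1 g2 g3 g4) =
     quartic (2 * (g0 * g2 - g1\<^sup>2)) (g0 * g3 - g1 * g2) ((g0 * g4 + 2 * g1 * g3 - 3 * g2\<^sup>2) / 3)
       (g1 * g4 - g2 * g3) (2 * (g2 * g4 - g3\<^sup>2))"
proof -
  have 6: "6 * cst (a / 3) = 2 * cst a" for a :: 'a
    by (simp only: numeral_bpoly_cst hom_cst(4)[symmetric]) (simp add: field_simps)
  have *: "quartic (2 * (g0 * g2 - g1\<^sup>2)) (g0 * g3 - g1 * g2) ((g0 * g4 + 2 * g1 * g3 - 3 * g2\<^sup>2) / 3)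
       (g1 * g4 - g2 * g3) (2 * (g2 * g4 - g3\<^sup>2)) =
     2 * (cst g0 * cst g2 - cst g1 ^ 2) * X0 ^ 4 + 4 * (cst g0 * cst g3 - cst g1 * cst g2) * X0 ^ 3 * X1
       + 2 * (cst g0 * cst g4 + 2 * cst g1 * cst g3 - 3 * cst g2 ^ 2) * X0\<^sup>2 * X1\<^sup>2
       + 4 * (cst g1 * cst g4 - cst g2 * cst g3) * X0 * X1 ^ 3 + 2 * (cst g2 * cst g4 - cst g3 ^ 2) * X1 ^ 4" (is "?L = ?R")
    unfolding quartic_eq 6 by (simp only: hom_cst)
  have "transvectant 4 4 2 (quartic g0 g1 g2 g3 g4) (quartic g0 g1 g2 g3 g4) = cst (1 / 144) * (144 * ?R)"
    unfolding transvectant_def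
  proof (rule arg_cong2[where f = "(*)"])
    show "(\<Sum>l\<le>2. (-1) ^ l * of_nat (2 choose l) *
        (D0 ^^ (2 - l)) ((D1 ^^ l) (quartic g0 g1 g2 g3 g4)) * (D0 ^^ l) ((D1 ^^ (2 - l)) (quartic g0 g1 g2 g3 g4))) = 144 * ?R"
      by (simp add: numeral_eq_Suc atMost_Suc quartic_eq) (simp add: algebra_simps)
  qed (simp add: fact_numeral)
  also have "\<dots> = ?R"
    by (simp add: numeral_bpoly_cst[of "num.Bit0 (num.Bit0 (num.Bit0 (num.Bit0 (num.Bit1 (num.Bit0 (num.Bit0 num.One))))))"]
        mult.assoc[symmetric] hom_cst(4)[symmetric] del: hom_cst) (simp add: hom_cst)
  finally show ?thesis
    unfolding * .
qed

lemma jacobian_quartics: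
  "transvectant 4 4 1 (quartic g0 g1 g2 g3 g4) (quartic h0 h1 h2 h3 h4) =
     form_of_list [g0 * h1 - g1 * h0, 3 * (g0 * h2 - g2 * h0), 3 * (g0 * h3 + 2 * g1 * h2 - 2 * g2 * h1 - g3 * h0),
       g0 * h4 + 8 * g1 * h3 - 8 * g3 * h1 - g4 * h0, 3 * (g1 * h4 + 2 * g2 * h3 - 2 * g3 * h2 - g4 * h1),
       3 * (g2 * h4 - g4 * h2), g3 * h4 - g4 * h3]" (is "_ = ?R")
proof -
  have "transvectant 4 4 1 (quartic g0 g1 g2 g3 g4) (quartic h0 h1 h2 h3 h4) = cst (1 / 16) * (16 * ?R)"
    unfolding transvectant_def
  proof (rule arg_cong2[where f = "(*)"])
    show "(\<Sum>l\<le>1. (-1) ^ l * of_nat (1 choose l) *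
        (D0 ^^ (1 - l)) ((D1 ^^ l) (quartic g0 g1 g2 g3 g4)) * (D0 ^^ l) ((D1 ^^ (1 - l)) (quartic h0 h1 h2 h3 h4))) = 16 * ?R"
      by (simp add: numeral_eq_Suc atMost_Suc quartic_eq sextic_eq hom_cst) (simp add: algebra_simps)
  qed (simp add: fact_numeral)
  also have "\<dots> = ?R"
    by (simp add: numeral_bpoly_cst[of "num.Bit0 (num.Bit0 (num.Bit0 (num.Bit0 num.One)))"]
        mult.assoc[symmetric] hom_cst(4)[symmetric] del: hom_cst) (simp add: hom_cst)
  finally show ?thesis .
qed

lemma quadratic_square:
  "quadratic u ^ 2 = quartic ((u $ 1)\<^sup>2) (u $ 1 * u $ 2) ((u $ 1 * u $ 3 + 2 * (u $ 2)\<^sup>2) / 3) (u $ 2 * u $ 3) ((u $ 3)\<^sup>2)"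
  for u :: "'a::field_char_0 ^ 3"
proof -
  have 6: "6 * cst (a / 3) = 2 * cst a" for a :: 'a
    by (simp only: numeral_bpoly_cst hom_cst(4)[symmetric]) (simp add: field_simps)
  show ?thesis
    unfolding quartic_eq quadratic_eq 6 hom_cst by (simp add: algebra_simps power2_eq_square numeral_eq_Suc)
qed

lemma quadratic_cube:
  "quadratic u ^ 3 = form_of_list [u $ 1 ^ 3, 6 * (u $ 1)\<^sup>2 * u $ 2, 3 * (u $ 1)\<^sup>2 * u $ 3 + 12 * u $ 1 * (u $ 2)\<^sup>2,
     12 * u $ 1 * u $ 2 * u $ 3 + 8 * u $ 2 ^ 3, 3 * u $ 1 * (u $ 3)\<^sup>2 + 12 * (u $ 2)\<^sup>2 * u $ 3,
     6 * u $ 2 * (u $ 3)\<^sup>2, u $ 3 ^ 3]"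
  for u :: "'a::field_char_0 ^ 3"
  unfolding sextic_eq quadratic_eq hom_cst by (simp add: algebra_simps numeral_eq_Suc)

section \<open>The three quadratic covariants and their Gram matrix\<close>

text \<open>
  This is \<open>(u, w)\<^sub>2\<close>, a scalar multiple of the polar form of the discriminant.
\<close>
definition discr_form :: "'a::comm_ring_1 ^ 3 \<Rightarrow> 'a ^ 3 \<Rightarrow> 'a" where
  "discr_form u w = u $ 1 * w $ 3 - 2 * u $ 2 * w $ 2 + u $ 3 * w $ 1"

text \<open>
  This is \<open>(g, u w)\<^sub>4\<close> for quadratic forms \<open>u\<close>, \<open>w\<close>.
\<close>
definition quartic_pairing :: "'a \<Rightarrow> 'a \<Rightarrow> 'a \<Rightarrow> 'a \<Rightarrow> 'a \<Rightarrow> 'a ^ 3 \<Rightarrow> 'a ^ 3 \<Rightarrow> 'a::comm_ring_1" where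
  "quartic_pairing g0 g1 g2 g3 g4 u w = g4 * (u $ 1 * w $ 1) - 2 * g3 * (u $ 1 * w $ 2 + u $ 2 * w $ 1)
     + g2 * (u $ 1 * w $ 3 + 4 * u $ 2 * w $ 2 + u $ 3 * w $ 1) - 2 * g1 * (u $ 2 * w $ 3 + u $ 3 * w $ 2) + g0 * (u $ 3 * w $ 3)"

text \<open>
  This is the coefficient vector of \<open>(u, g)\<^sub>2\<close>.
\<close>
definition contract_quartic :: "'a \<Rightarrow> 'a \<Rightarrow> 'a \<Rightarrow> 'a \<Rightarrow> 'a \<Rightarrow> 'a ^ 3 \<Rightarrow> 'a::comm_ring_1 ^ 3" where
  "contract_quartic g0 g1 g2 g3 g4 u = vector [u $ 1 * g2 - 2 * u $ 2 * g1 + u $ 3 * g0,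
     u $ 1 * g3 - 2 * u $ 2 * g2 + u $ 3 * g1, u $ 1 * g4 - 2 * u $ 2 * g3 + u $ 3 * g2]"

text \<open>
  This is the coefficient vector of \<open>(w, u)\<^sub>1\<close>. Up to the identification of a quadratic form with a
  linear functional by \<open>discr_form\<close>, it is the cross product.
\<close>
definition jacobian :: "'a::field_char_0 ^ 3 \<Rightarrow> 'a ^ 3 \<Rightarrow> 'a ^ 3" where
  "jacobian w u = vector [w $ 1 * u $ 2 - w $ 2 * u $ 1, (w $ 1 * u $ 3 - w $ 3 * u $ 1) / 2, w $ 2 * u $ 3 - w $ 3 * u $ 2]"

text \<open>
  The rows are the coefficient vectors of \<open>f\<close>, \<open>(f, g)\<^sub>2\<close> and \<open>((f, g)\<^sub>2, f)\<^sub>1\<close>.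
\<close>
definition covariant_rows :: "'a \<Rightarrow> 'a \<Rightarrow> 'a \<Rightarrow> 'a \<Rightarrow> 'a \<Rightarrow> 'a ^ 3 \<Rightarrow> 'a::field_char_0 ^ 3 ^ 3" where
  "covariant_rows g0 g1 g2 g3 g4 u = (let w = contract_quartic g0 g1 g2 g3 g4 u in vector [u, w, jacobian w u])"

lemma basic_invs_eq:
  "basic_invs (quadratic u) (quartic g0 g1 g2 g3 g4) =
    (let h0 = 2 * (g0 * g2 - g1\<^sup>2); h1 = g0 * g3 - g1 * g2; h2 = (g0 * g4 + 2 * g1 * g3 - 3 * g2\<^sup>2) / 3;
         h3 = g1 * g4 - g2 * g3; h4 = 2 * (g2 * g4 - g3\<^sup>2) in
     (discr_form u u, 2 * (g0 * g4 - 4 * g1 * g3 + 3 * g2\<^sup>2),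
      h0 * g4 - 4 * h1 * g3 + 6 * h2 * g2 - 4 * h3 * g1 + h4 * g0,
      quartic_pairing g0 g1 g2 g3 g4 u u, quartic_pairing h0 h1 h2 h3 h4 u u,
      (g0 * h1 - g1 * h0) * u $ 3 ^ 3 - 3 * (g0 * h2 - g2 * h0) * u $ 2 * (u $ 3)\<^sup>2
      + 3 * (g0 * h3 + 2 * g1 * h2 - 2 * g2 * h1 - g3 * h0) * (u $ 1 * (u $ 3)\<^sup>2 + 4 * (u $ 2)\<^sup>2 * u $ 3) / 5
      - (g0 * h4 + 8 * g1 * h3 - 8 * g3 * h1 - g4 * h0) * (3 * u $ 1 * u $ 2 * u $ 3 + 2 * u $ 2 ^ 3) / 5
      + 3 * (g1 * h4 + 2 * g2 * h3 - 2 * g3 * h2 - g4 * h1) * ((u $ 1)\<^sup>2 * u $ 3 + 4 * u $ 1 * (u $ 2)\<^sup>2) / 5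
      - 3 * (g2 * h4 - g4 * h2) * (u $ 1)\<^sup>2 * u $ 2 + (g3 * h4 - g4 * h3) * u $ 1 ^ 3))"
  unfolding basic_invs_def Let_def hessian_quartic jacobian_quartics quadratic_square quadratic_cube
    full_transvectant_quadratic full_transvectant_quartic full_transvectant_sextic prod.inject discr_form_def quartic_pairing_def
  by (intro conjI; simp add: field_simps power2_eq_square power3_eq_cube)

lemma discr_form_commute: "discr_form u w = discr_form w u"
  by (simp add: discr_form_def)

lemma quartic_pairing_commute: "quartic_pairing g0 g1 g2 g3 g4 u w = quartic_pairing g0 g1 g2 g3 g4 w u"
  by (simp add: quartic_pairing_def algebra_simps)

lemma discr_form_jacobian_self: "discr_form (jacobian w u) u = 0" "discr_form (jacobian w u) w = 0"
  by (simp_all add: discr_form_def jacobian_def field_simps)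

lemma discr_form_jacobian_jacobian: "discr_form (jacobian w u) (jacobian w u) = (discr_form u u * discr_form w w - (discr_form u w)\<^sup>2) / 2"
  by (simp add: discr_form_def jacobian_def field_simps power2_eq_square)

lemma quartic_pairing_self: "quartic_pairing g0 g1 g2 g3 g4 u w = discr_form (contract_quartic g0 g1 g2 g3 g4 u) w"
  by (simp add: discr_form_def quartic_pairing_def contract_quartic_def algebra_simps)

text \<open>
  The classical syzygy: \<open>(w, u)\<^sub>1\<^sup>2\<close> equals
  \<open>- ((u, u)\<^sub>2 w\<^sup>2 - 2 (u, w)\<^sub>2 u w + (w, w)\<^sub>2 u\<^sup>2) / 2\<close>. Pairing it with \<open>g\<close> reduces the seventh
  degree invariant \<open>(g, u\<^sub>3\<^sup>2)\<^sub>4\<close> to invariants of lower degree.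
\<close>
lemma quartic_pairing_jacobian_jacobian:
  fixes g0 g1 g2 g3 g4 :: "'a::field_char_0"
  defines "q \<equiv> quartic_pairing g0 g1 g2 g3 g4"
  shows "q (jacobian w u) (jacobian w u) = - (discr_form u u * q w w - 2 * discr_form u w * q u w + discr_form w w * q u u) / 2"
  unfolding q_def by (simp add: discr_form_def jacobian_def quartic_pairing_def field_simps power2_eq_square)

lemma det_jacobian: "det (vector [u, w, jacobian w u]) = - discr_form (jacobian w u) (jacobian w u)"
  by (simp add: det_3 discr_form_def jacobian_def field_simps power2_eq_square)

text \<open>
  This identifies the polynomials \<open>C_tilde\<close>, \<open>A_tilde\<close>, \<open>B_tilde\<close> in the basic invariants with the
  transvectants of the three covariants. The entries without \<open>u\<^sub>3\<close> and the entry \<open>(g, u\<^sub>2 u\<^sub>3)\<^sub>4\<close> come down to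
  expansions in coordinates. The others follow from \<open>u\<^sub>3\<close> being orthogonal to \<open>u\<^sub>1\<close> and \<open>u\<^sub>2\<close> and from the identities
  for \<open>(u\<^sub>3, u\<^sub>3)\<^sub>2\<close> and \<open>u\<^sub>3\<^sup>2\<close>. The determinant of the three rows is a triple product in which the third
  vector is the cross product of the other two, so it is \<open>(u\<^sub>3, u\<^sub>3)\<^sub>2\<close> up to sign. That it is a
  polynomial in the invariants, sign included, is what later makes \<open>\<beta>\<close> rational.
\<close>
lemma gram_covariants:
  assumes "basic_invs (quadratic u) (quartic g0 g1 g2 g3 g4) = v"
  defines "U \<equiv> covariant_rows g0 g1 g2 g3 g4 u"
  shows "discr_form (U $ i) (U $ j) = C_tilde v $ i $ j"
    and "quartic_pairing g0 g1 g2 g3 g4 (U $ i) (U $ j) = B_tilde v $ i $ j"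
    and "A_tilde v $ i = C_tilde v $ 1 $ i"
    and "det U = - c_tilde v"
proof -
  define w where "w = contract_quartic g0 g1 g2 g3 g4 u"
  obtain d i j a b c where v: "v = (d, i, j, a, b, c)" by (cases v) auto
  note inv = assms(1)[unfolded v basic_invs_eq Let_def prod.inject]
  let ?q = "quartic_pairing g0 g1 g2 g3 g4"
  have C11: "discr_form u u = d" and B11: "?q u u = a" using inv by auto
  have C12: "discr_form w u = a" using B11 by (simp add: w_def quartic_pairing_self)
  have i: "i = 2 * (g0 * g4 - 4 * g1 * g3 + 3 * g2\<^sup>2)"
    and j: "j = 2 * (g0 * g2 - g1\<^sup>2) * g4 - 4 * (g0 * g3 - g1 * g2) * g3 + 6 * ((g0 * g4 + 2 * g1 * g3 - 3 * g2\<^sup>2) / 3) * g2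
        - 4 * (g1 * g4 - g2 * g3) * g1 + 2 * (g2 * g4 - g3\<^sup>2) * g0"
    using inv by auto
  have b: "b = quartic_pairing (2 * (g0 * g2 - g1\<^sup>2)) (g0 * g3 - g1 * g2) ((g0 * g4 + 2 * g1 * g3 - 3 * g2\<^sup>2) / 3)
      (g1 * g4 - g2 * g3) (2 * (g2 * g4 - g3\<^sup>2)) u u"
    using inv by simp
  have C22: "discr_form w w = b + 1/3 * i * d"
    unfolding C11[symmetric] b i
    by (simp add: w_def contract_quartic_def discr_form_def quartic_pairing_def field_simps power2_eq_square)
  have B12: "?q u w = b + 1/3 * i * d"
    using C22 by (simp add: quartic_pairing_self w_def)
  have B22: "?q w w = 1/2 * i * a + 1/3 * j * d"
    unfolding C11[symmetric] B11[symmetric] i j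
    by (simp add: w_def contract_quartic_def discr_form_def quartic_pairing_def field_simps power2_eq_square)
  have B13: "?q u (jacobian w u) = 0"
    using discr_form_jacobian_self(2)[of w u] discr_form_commute[of w "jacobian w u"] by (simp add: quartic_pairing_self flip: w_def)
  have B23: "?q w (jacobian w u) = - c"
  proof -
    note c = inv[THEN conjunct2, THEN conjunct2, THEN conjunct2, THEN conjunct2, THEN conjunct2, symmetric]
    show ?thesis
      unfolding c by (simp add: w_def contract_quartic_def quartic_pairing_def jacobian_def field_simps power2_eq_square power3_eq_cube)
  qed
  have C33: "discr_form (jacobian w u) (jacobian w u) = c_tilde v"
    unfolding discr_form_jacobian_jacobian using C11 C12 C22 by (simp add: v discr_form_commute field_simps power2_eq_square)
  have B33: "?q (jacobian w u) (jacobian w u) = 1/2 * a * b - 1/12 * i * a * d - 1/6 * j * d\<^sup>2"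
    unfolding quartic_pairing_jacobian_jacobian discr_form_commute[of u w] C11 C12 C22 B11 B12 B22
    by (simp add: field_simps power2_eq_square)
  have U: "U = vector [u, w, jacobian w u]"
    by (simp add: U_def covariant_rows_def w_def Let_def)
  have sym: "discr_form u w = a" "discr_form u (jacobian w u) = 0" "discr_form w (jacobian w u) = 0"
      "?q w u = b + 1/3 * i * d" "?q (jacobian w u) u = 0" "?q (jacobian w u) w = - c"
    unfolding discr_form_commute[of u w] discr_form_commute[of u "jacobian w u"] discr_form_commute[of w "jacobian w u"]
      quartic_pairing_commute[of _ _ _ _ _ w u] quartic_pairing_commute[of _ _ _ _ _ "jacobian w u" u] quartic_pairing_commute[of _ _ _ _ _ "jacobian w u" w]
    by (rule C12 B12 B13 B23 discr_form_jacobian_self)+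
  note facts = C11 C12 C22 B11 B12 B22 B13 B23 C33 B33 discr_form_jacobian_self sym
  have "\<forall>i j. discr_form (U $ i) (U $ j) = C_tilde v $ i $ j"
    unfolding forall_3 U by (simp add: v facts[unfolded v])
  then show "discr_form (U $ i) (U $ j) = C_tilde v $ i $ j" for i j by blast
  have "\<forall>i j. quartic_pairing g0 g1 g2 g3 g4 (U $ i) (U $ j) = B_tilde v $ i $ j"
    unfolding forall_3 U by (simp add: v facts[unfolded v])
  then show "quartic_pairing g0 g1 g2 g3 g4 (U $ i) (U $ j) = B_tilde v $ i $ j" for i j by blast
  have "\<forall>i. A_tilde v $ i = C_tilde v $ 1 $ i"
    unfolding forall_3 by (simp add: v)
  then show "A_tilde v $ i = C_tilde v $ 1 $ i" for i by blast
  show "det U = - c_tilde v"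
    unfolding U det_jacobian C33 ..
qed

section \<open>Recovering the pair of forms from a dual basis\<close>

definition discr_matrix :: "'a::comm_ring_1 ^ 3 ^ 3" where
  "discr_matrix = vector [vector [0, 0, 1], vector [0, - 2, 0], vector [1, 0, 0]]"

definition discr_matrix_inv :: "'a::field_char_0 ^ 3 ^ 3" where
  "discr_matrix_inv = vector [vector [0, 0, 1], vector [0, - 1 / 2, 0], vector [1, 0, 0]]"

lemma discr_matrix_inverse: "discr_matrix ** discr_matrix_inv = mat 1" "discr_matrix_inv ** discr_matrix = mat 1"
  by (simp_all add: vec_eq_iff forall_3 matrix_matrix_mult_def sum_3 discr_matrix_def discr_matrix_inv_def mat_def)

lemma gram_matrix: "(U ** discr_matrix ** transpose U) $ i $ j = discr_form (U $ i) (U $ j)"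
  by (simp add: matrix_matrix_mult_def sum_3 discr_matrix_def transpose_def discr_form_def algebra_simps)

lemma matrix_inv_cancel:
  fixes A :: "'a::field ^ 'n ^ 'n"
  assumes "det A \<noteq> 0"
  shows "A ** matrix_inv A = mat 1" "matrix_inv A ** A = mat 1"
  using someI_ex[of "\<lambda>B. A ** B = mat 1 \<and> B ** A = mat 1"] assms
  unfolding invertible_det_nz[symmetric] invertible_def matrix_inv_def by auto

lemma matrix_cancel_both:
  fixes A B M N :: "'a::field ^ 'n ^ 'n"
  assumes "A ** M ** B = A ** N ** B" "det A \<noteq> 0" "det B \<noteq> 0"
  shows "M = N"
proof -
  have "matrix_inv A ** (A ** Z ** B) ** matrix_inv B = (matrix_inv A ** A) ** Z ** (B ** matrix_inv B)" for Z
    by (simp only: matrix_mul_assoc)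
  then have "matrix_inv A ** (A ** Z ** B) ** matrix_inv B = Z" for Z
    by (simp add: matrix_inv_cancel assms)
  then show ?thesis
    using assms(1) by metis
qed

text \<open>
  Everything follows from \<open>U D U\<^sup>T = C\<close>, where \<open>D\<close> is \<open>discr_matrix\<close>. The last equation puts the
  dual basis on the conic, because \<open>D\<^sup>-\<^sup>1\<close> is the matrix of a quadratic relation between
  \<open>X0\<^sup>2\<close>, \<open>2 X0 X1\<close> and \<open>X1\<^sup>2\<close>.
\<close>
lemma dual_basis:
  fixes U C :: "'a::field_char_0 ^ 3 ^ 3"
  assumes gram: "\<And>i j. discr_form (U $ i) (U $ j) = C $ i $ j" and "det C \<noteq> 0"
  defines "V \<equiv> matrix_inv C ** U"
  shows "transpose U ** V = discr_matrix_inv"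
    and "C ** V = U"
    and "\<And>i j. discr_form (V $ i) (V $ j) = matrix_inv C $ i $ j"
    and "transpose V ** C ** V = discr_matrix_inv"
proof -
  note inv = matrix_inv_cancel[OF assms(2)]
  have C: "C = U ** discr_matrix ** transpose U"
    unfolding vec_eq_iff gram_matrix using gram by simp
  have "transpose C = C"
    using gram by (simp add: vec_eq_iff transpose_def) (metis discr_form_commute)
  show CV: "C ** V = U"
    by (simp add: V_def matrix_mul_assoc inv)
  \<comment> \<open>A left inverse of a square matrix is a right inverse; this moves \<open>U\<^sup>T V\<close> together.\<close>
  have "(matrix_inv C ** U) ** (discr_matrix ** transpose U) = mat 1"
    using inv(2) by (subst (asm) (2) C) (simp add: matrix_mul_assoc)
  then have "discr_matrix ** (transpose U ** V) = mat 1"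
    unfolding V_def[symmetric] by (subst (asm) matrix_left_right_inverse) (simp add: matrix_mul_assoc)
  then have "discr_matrix_inv ** discr_matrix ** (transpose U ** V) = discr_matrix_inv"
    by (metis matrix_mul_assoc matrix_mul_rid)
  then show UV: "transpose U ** V = discr_matrix_inv"
    by (simp add: discr_matrix_inverse)
  have VU: "transpose V ** C = transpose U"
    using arg_cong[OF CV, of transpose] by (simp add: matrix_transpose_mul \<open>transpose C = C\<close>)
  show "transpose V ** C ** V = discr_matrix_inv"
    by (simp add: VU UV)
  have "V ** discr_matrix ** transpose V = matrix_inv C"
  proof -
    have "C ** (V ** discr_matrix ** transpose V) = U ** discr_matrix ** transpose V"
      by (simp add: CV matrix_mul_assoc)
    also have "\<dots> = mat 1"
    proof -
      have "U ** discr_matrix ** transpose V ** C = C"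
        by (simp add: matrix_mul_assoc[symmetric] VU) (simp add: matrix_mul_assoc C[symmetric])
      then have "U ** discr_matrix ** transpose V ** (C ** matrix_inv C) = C ** matrix_inv C"
        by (metis matrix_mul_assoc)
      then show ?thesis by (simp add: inv)
    qed
    finally have "matrix_inv C ** C ** (V ** discr_matrix ** transpose V) = matrix_inv C"
      by (metis matrix_mul_assoc matrix_mul_rid)
    then show ?thesis by (simp add: inv)
  qed
  then show "discr_form (V $ i) (V $ j) = matrix_inv C $ i $ j" for i j
    unfolding gram_matrix[symmetric] by simp
qed

lemma reconstruct_quadratic:
  fixes C U V :: "'a::field_char_0 ^ 3 ^ 3"
  assumes "\<And>i. A $ i = C $ 1 $ i" "C ** V = U"
  shows "(\<Sum>i\<in>UNIV. cst (A $ i) * quadratic (V $ i)) = quadratic (U $ 1)"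
proof -
  have "U $ 1 $ k = C $ 1 $ 1 * V $ 1 $ k + C $ 1 $ 2 * V $ 2 $ k + C $ 1 $ 3 * V $ 3 $ k" for k
    unfolding assms(2)[symmetric] by (simp add: matrix_matrix_mult_def sum_3)
  then show ?thesis
    by (simp add: sum_3 assms(1) quadratic_eq hom_cst algebra_simps)
qed

text \<open>
  Expand \<open>B\<^sub>i\<^sub>j = (g, u\<^sub>i u\<^sub>j)\<^sub>4\<close> as a bilinear expression in the coefficients of \<open>u\<^sub>i\<close> and \<open>u\<^sub>j\<close>. The sums
  over \<open>i\<close> and \<open>j\<close> then replace these coefficients by those of \<open>\<Sum> u\<^sub>i \<otimes> u\<^sup>i\<close>, which is the
  inverse form \<open>D\<^sup>-\<^sup>1\<close>, and pairing \<open>g\<close> with \<open>D\<^sup>-\<^sup>1 \<otimes> D\<^sup>-\<^sup>1\<close> gives back \<open>g\<close>.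
\<close>
lemma reconstruct_quartic:
  fixes U V :: "'a::field_char_0 ^ 3 ^ 3"
  assumes B: "\<And>i j. quartic_pairing g0 g1 g2 g3 g4 (U $ i) (U $ j) = B $ i $ j" and UV: "transpose U ** V = discr_matrix_inv"
  shows "(\<Sum>i\<in>UNIV. \<Sum>j\<in>UNIV. cst (B $ i $ j) * quadratic (V $ i) * quadratic (V $ j)) = quartic g0 g1 g2 g3 g4"
proof -
  \<comment> \<open>The products \<open>z k\<close> stand for the coefficients of \<open>\<Sum> u\<^sub>i \<otimes> u\<^sup>i\<close>: as forms they are
    \<open>X1\<^sup>2\<close>, \<open>- X0 X1\<close>, \<open>X0\<^sup>2\<close>.\<close>
  define z where "z k = (\<Sum>i\<in>UNIV. cst (U $ i $ k) * quadratic (V $ i))" for k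
  have "U $ 1 $ k * V $ 1 $ l + U $ 2 $ k * V $ 2 $ l + U $ 3 $ k * V $ 3 $ l = discr_matrix_inv $ k $ l" for k l
    unfolding UV[symmetric] by (simp add: matrix_matrix_mult_def sum_3 transpose_def)
  then have "z k = quadratic (discr_matrix_inv $ k)" for k
    unfolding z_def sum_3 quadratic_eq by (simp add: sum_3 hom_cst algebra_simps flip: \<open>\<And>k l. _ = discr_matrix_inv $ k $ l\<close>)
  moreover have "2 * cst (- 1 / 2 :: 'a) = - 1"
    by (simp only: numeral_bpoly_cst hom_cst(4)[symmetric]) (simp add: hom_cst)
  ultimately have z: "z 1 = X1\<^sup>2" "z 2 = - (X0 * X1)" "z 3 = X0\<^sup>2"
    by (simp_all add: quadratic_eq discr_matrix_inv_def hom_cst) 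
  have "(\<Sum>i\<in>UNIV. \<Sum>j\<in>UNIV. cst (B $ i $ j) * quadratic (V $ i) * quadratic (V $ j)) =
      cst g4 * (z 1 * z 1) - 2 * cst g3 * (z 1 * z 2 + z 2 * z 1) + cst g2 * (z 1 * z 3 + 4 * z 2 * z 2 + z 3 * z 1)
      - 2 * cst g1 * (z 2 * z 3 + z 3 * z 2) + cst g0 * (z 3 * z 3)"
    unfolding B[symmetric] z_def sum_3 quartic_pairing_def hom_cst by (simp only: algebra_simps)
  also have "\<dots> = quartic g0 g1 g2 g3 g4"
    unfolding z quartic_eq by (simp add: algebra_simps power2_eq_square numeral_eq_Suc)
  finally show ?thesis .
qed

section \<open>Special orthogonal transformations of quadratic forms\<close>

text \<open>
  The action on coefficient vectors of the substitution \<open>X0 \<mapsto> p X0 + q X1\<close>, \<open>X1 \<mapsto> r X0 + s X1\<close>.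
\<close>
definition sym2 :: "'a \<Rightarrow> 'a \<Rightarrow> 'a \<Rightarrow> 'a \<Rightarrow> 'a ^ 3 \<Rightarrow> 'a::comm_ring_1 ^ 3" where
  "sym2 p q r s u = vector [u $ 1 * p\<^sup>2 + 2 * u $ 2 * (p * r) + u $ 3 * r\<^sup>2,
     u $ 1 * (p * q) + u $ 2 * (p * s + q * r) + u $ 3 * (r * s),
     u $ 1 * q\<^sup>2 + 2 * u $ 2 * (q * s) + u $ 3 * s\<^sup>2]"

lemma quadratic_sym2:
  "quadratic (sym2 p q r s u) = subst_form (quadratic u) (cst p * X0 + cst q * X1) (cst r * X0 + cst s * X1)"
  by (simp add: quadratic_eq sym2_def hom_subst generators_subst hom_cst algebra_simps power2_eq_square)

lemma degenerate_quadratic_is_square: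
  fixes u :: "'b::{field_char_0, alg_closed_field} ^ 3"
  assumes "discr_form u u = 0"
  obtains p q where "u = vector [p\<^sup>2, p * q, q\<^sup>2]"
proof -
  have *: "u $ 1 * u $ 3 = (u $ 2)\<^sup>2"
    using assms by (simp add: discr_form_def power2_eq_square)
  obtain p where p: "p\<^sup>2 = u $ 1" using nth_root_exists[of 2] by auto
  obtain q where q: "q\<^sup>2 = u $ 3" using nth_root_exists[of 2] by auto
  have "(p * q)\<^sup>2 = (u $ 2)\<^sup>2" by (simp add: power_mult_distrib p q *)
  then have "p * q = u $ 2 \<or> p * (- q) = u $ 2" by (auto simp: power2_eq_iff)
  then have "u = vector [p\<^sup>2, p * q, q\<^sup>2] \<or> u = vector [p\<^sup>2, p * (- q), (- q)\<^sup>2]"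
    using p q by (auto simp: vec_eq_iff forall_3)
  then show ?thesis using that by blast
qed

text \<open>
  The exceptional surjection \<open>SL\<^sub>2 \<rightarrow> SO\<^sub>3\<close>. The linear map \<open>M\<close> that sends \<open>V\<close> to \<open>W\<close> preserves
  \<open>discr_form\<close>, so it sends the squares \<open>X0\<^sup>2\<close> and \<open>X1\<^sup>2\<close> to degenerate forms, that is, to squares
  of linear forms \<open>l\<^sub>0\<close> and \<open>l\<^sub>1\<close>. The value \<open>(X0\<^sup>2, X1\<^sup>2)\<^sub>2 = 1\<close> makes \<open>l\<^sub>0\<close>, \<open>l\<^sub>1\<close> unimodular up
  to sign, and \<open>M\<close> sends \<open>X0 X1\<close>, which is orthogonal to both squares, to \<open>l\<^sub>0 l\<^sub>1\<close> by \<open>det M = 1\<close>.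
\<close>
lemma special_orthogonal_is_sym2:
  fixes V W :: "'b::{field_char_0, alg_closed_field} ^ 3 ^ 3"
  assumes gram: "\<And>i j. discr_form (W $ i) (W $ j) = discr_form (V $ i) (V $ j)" and det: "det W = det V" "det V \<noteq> 0"
  obtains p q r s where "p * s - q * r = 1" "\<And>i. W $ i = sym2 p q r s (V $ i)"
proof -
  define M where "M = matrix_inv V ** W"
  have W: "W = V ** M"
    by (simp add: M_def matrix_mul_assoc matrix_inv_cancel[OF det(2)])
  then have "det M = 1"
    using det by (simp add: det_mul)
  have "W ** discr_matrix ** transpose W = V ** discr_matrix ** transpose V"
    unfolding vec_eq_iff gram_matrix using gram by simp
  then have "V ** (M ** discr_matrix ** transpose M) ** transpose V = V ** discr_matrix ** transpose V"
    by (simp add: W matrix_transpose_mul matrix_mul_assoc)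
  then have "M ** discr_matrix ** transpose M = discr_matrix"
    by (rule matrix_cancel_both) (use det in simp_all)
  then have M: "discr_form (M $ i) (M $ j) = discr_matrix $ i $ j" for i j
    using gram_matrix[of M i j] by simp
  obtain p q where 1: "M $ 1 = vector [p\<^sup>2, p * q, q\<^sup>2]"
    using degenerate_quadratic_is_square M[of 1 1] by (auto simp: discr_matrix_def)
  obtain r s where 3: "M $ 3 = vector [r\<^sup>2, r * s, s\<^sup>2]"
    using degenerate_quadratic_is_square M[of 3 3] by (auto simp: discr_matrix_def)
  have "(p * s - q * r)\<^sup>2 = 1"
    using M[of 1 3] by (simp add: 1 3 discr_form_def discr_matrix_def algebra_simps power2_eq_square)
  \<comment> \<open>Only the product of signs is visible in the square, so \<open>(r, s)\<close> may be replaced by \<open>(- r, - s)\<close>.\<close>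
  then have "\<exists>r s. M $ 3 = vector [r\<^sup>2, r * s, s\<^sup>2] \<and> p * s - q * r = 1"
  proof (cases "p * s - q * r = 1")
    case False
    then have "p * s - q * r = - 1"
      using \<open>(p * s - q * r)\<^sup>2 = 1\<close> by (simp add: power2_eq_1_iff)
    then have "p * (- s) - q * (- r) = 1"
      by (simp add: algebra_simps)
    moreover have "M $ 3 = vector [(- r)\<^sup>2, (- r) * (- s), (- s)\<^sup>2]"
      using 3 by simp
    ultimately show ?thesis by blast
  qed (use 3 in blast)
  then obtain r s where 3: "M $ 3 = vector [r\<^sup>2, r * s, s\<^sup>2]" and 13: "p * s - q * r = 1" by blast
  define x y z where "x = M $ 2 $ 1" and "y = M $ 2 $ 2" and "z = M $ 2 $ 3"
  have 12: "x * q\<^sup>2 - 2 * y * (p * q) + z * p\<^sup>2 = 0" and 23: "x * s\<^sup>2 - 2 * y * (r * s) + z * r\<^sup>2 = 0"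
    using M[of 2 1] M[of 2 3] by (auto simp: 1 3 discr_form_def discr_matrix_def x_def y_def z_def)
  have "(p * s - q * r) * (- x * (q * s) + y * (p * s + q * r) - z * (p * r)) = 1"
    using \<open>det M = 1\<close> by (simp add: det_3 1 3 x_def y_def z_def algebra_simps power2_eq_square)
  then have 123: "- x * (q * s) + y * (p * s + q * r) - z * (p * r) = 1"
    by (simp add: 13)
  \<comment> \<open>Cramer's rule for the linear system \<open>12\<close>, \<open>23\<close>, \<open>123\<close> in \<open>x\<close>, \<open>y\<close>, \<open>z\<close>, whose
    determinant is a power of \<open>p s - q r\<close>.\<close>
  have "x * (p * s - q * r)\<^sup>2 = p\<^sup>2 * (x * s\<^sup>2 - 2 * y * (r * s) + z * r\<^sup>2) + r\<^sup>2 * (x * q\<^sup>2 - 2 * y * (p * q) + z * p\<^sup>2)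
      + 2 * (p * r) * (- x * (q * s) + y * (p * s + q * r) - z * (p * r))"
    by (simp add: algebra_simps power2_eq_square)
  moreover have "y * (p * s - q * r)\<^sup>2 = p * q * (x * s\<^sup>2 - 2 * y * (r * s) + z * r\<^sup>2) + r * s * (x * q\<^sup>2 - 2 * y * (p * q) + z * p\<^sup>2)
      + (p * s + q * r) * (- x * (q * s) + y * (p * s + q * r) - z * (p * r))"
    by (simp add: algebra_simps power2_eq_square)
  moreover have "z * (p * s - q * r)\<^sup>2 = q\<^sup>2 * (x * s\<^sup>2 - 2 * y * (r * s) + z * r\<^sup>2) + s\<^sup>2 * (x * q\<^sup>2 - 2 * y * (p * q) + z * p\<^sup>2)
      + 2 * (q * s) * (- x * (q * s) + y * (p * s + q * r) - z * (p * r))"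
    by (simp add: algebra_simps power2_eq_square)
  ultimately have 2: "x = 2 * (p * r)" "y = p * s + q * r" "z = 2 * (q * s)"
    unfolding 12 23 123 13 by simp_all
  have "W $ i = sym2 p q r s (V $ i)" for i
    unfolding W vec_eq_iff forall_3
    using 2 by (simp add: matrix_matrix_mult_def sum_3 1 3 sym2_def x_def y_def z_def)
  with 13 show ?thesis by (rule that)
qed

section \<open>Equivariance of transvectants\<close>

text \<open>
  The ring of bivariate polynomials is generated by the constants and the two variables, so identities
  between homomorphisms and derivations need to be checked on these only.
\<close>
lemma bpoly_induct [case_names cst add X0 X1]:
  fixes F :: "'a::comm_ring_1 bpoly"
  assumes "\<And>a. Q (cst a)" "\<And>F G. Q F \<Longrightarrow> Q G \<Longrightarrow> Q (F + G)" "\<And>F. Q F \<Longrightarrow> Q (X0 * F)" "\<And>F. Q F \<Longrightarrow> Q (X1 * F)"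
  shows "Q F"
proof (induction F)
  case 0
  then show ?case using assms(1)[of 0] by (simp add: hom_cst)
next
  case (pCons f F)
  have "Q [:f:]"
  proof (induction f)
    case 0
    then show ?case using assms(1)[of 0] by (simp add: hom_cst)
  next
    case (pCons a f)
    have "[:pCons a f:] = cst a + X0 * [:f:]"
      by (simp add: cst_def X0_def)
    then show ?case using pCons assms by metis
  qed
  moreover have "pCons f F = [:f:] + X1 * F"
    by (simp add: X1_def)
  ultimately show ?case using pCons assms by metis
qed

lemma is_hom_ext:
  assumes "is_hom h" "is_hom k" "\<And>a. h (cst a) = k (cst a)" "h X0 = k X0" "h X1 = k X1"
  shows "h F = k F"
  by (induction F rule: bpoly_induct) (simp_all add: assms is_hom_simps[OF assms(1)] is_hom_simps[OF assms(2)])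

lemma D0_D1_commute: "D0 (D1 F) = D1 (D0 F)"
  by (induction F rule: bpoly_induct) simp_all

abbreviation linear_form :: "'a::comm_ring_1 \<Rightarrow> 'a \<Rightarrow> 'a bpoly" where
  "linear_form p q \<equiv> cst p * X0 + cst q * X1"

lemma chain_rule:
  fixes p q r s :: "'a::field_char_0"
  defines "S \<equiv> \<lambda>F. subst_form F (linear_form p q) (linear_form r s)"
  shows "D0 (S F) = cst p * S (D0 F) + cst r * S (D1 F)" and "D1 (S F) = cst q * S (D0 F) + cst s * S (D1 F)"
  unfolding S_def
  by (induction F rule: bpoly_induct) (simp_all add: hom_subst generators_subst algebra_simps)

text \<open>
  The transvectant without its normalizing factor.
\<close>
definition omega_process :: "nat \<Rightarrow> 'a::field_char_0 bpoly \<Rightarrow> 'a bpoly \<Rightarrow> 'a bpoly" where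
  "omega_process r F G = (\<Sum>l\<le>r. (-1) ^ l * of_nat (r choose l) *
        (D0 ^^ (r - l)) ((D1 ^^ l) F) * (D0 ^^ l) ((D1 ^^ (r - l)) G))"

lemma D_iter_linear:
  "(D0 ^^ n) (cst a * F + cst b * G) = cst a * (D0 ^^ n) F + cst b * (D0 ^^ n) G"
  "(D1 ^^ n) (cst a * F + cst b * G) = cst a * (D1 ^^ n) F + cst b * (D1 ^^ n) G"
  by (induction n) simp_all

lemma omega_process_linear:
  "omega_process r (cst a * F + cst b * G) K = cst a * omega_process r F K + cst b * omega_process r G K"
  "omega_process r K (cst a * F + cst b * G) = cst a * omega_process r K F + cst b * omega_process r K G"
  unfolding omega_process_def D_iter_linear sum_distrib_left sum.distrib[symmetric] by (simp_all add: algebra_simps)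

text \<open>
  Pascal's rule. It expresses that the process is the iteration of the operator
  \<open>\<partial>\<^sub>0 \<otimes> \<partial>\<^sub>1 - \<partial>\<^sub>1 \<otimes> \<partial>\<^sub>0\<close> of Cayley, which makes induction on the order possible.
\<close>
lemma omega_process_Suc: "omega_process (Suc r) F G = omega_process r (D0 F) (D1 G) - omega_process r (D1 F) (D0 G)"
proof -
  define t where "t l = (D0 ^^ (Suc r - l)) ((D1 ^^ l) F) * (D0 ^^ l) ((D1 ^^ (Suc r - l)) G)" for l
  have D01: "(D1 ^^ n) (D0 F) = D0 ((D1 ^^ n) F)" for n and F :: "'a bpoly"
    by (induction n) (simp_all add: D0_D1_commute)
  have shift: "(D0 ^^ n) (D0 F) = (D0 ^^ Suc n) F" "(D1 ^^ n) (D1 F) = (D1 ^^ Suc n) F" for n and F :: "'a bpoly"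
    by (simp_all add: funpow_swap1)
  have A: "omega_process r (D0 F) (D1 G) = (\<Sum>l\<le>r. (-1) ^ l * of_nat (r choose l) * t l)"
    unfolding omega_process_def t_def D01 shift by (rule sum.cong) (auto simp: Suc_diff_le mult.assoc)
  have B: "omega_process r (D1 F) (D0 G) = (\<Sum>l\<le>r. (-1) ^ l * of_nat (r choose l) * t (Suc l))"
    unfolding omega_process_def t_def D01 shift by (rule sum.cong) (auto simp: mult.assoc)
  have "omega_process (Suc r) F G = (\<Sum>l\<le>Suc r. (-1) ^ l * of_nat (Suc r choose l) * t l)"
    unfolding omega_process_def t_def by (rule sum.cong) (auto simp: mult.assoc)
  also have "\<dots> = t 0 + (\<Sum>l\<le>r. (-1) ^ Suc l * of_nat (Suc r choose Suc l) * t (Suc l))"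
    by (subst sum.atMost_Suc_shift) simp
  also have "\<dots> = (t 0 + (\<Sum>l\<le>r. (-1) ^ Suc l * of_nat (r choose Suc l) * t (Suc l)))
      - (\<Sum>l\<le>r. (-1) ^ l * of_nat (r choose l) * t (Suc l))"
    by (simp add: sum_subtractf[symmetric] sum.distrib[symmetric] sum_negf[symmetric] algebra_simps)
  also have "t 0 + (\<Sum>l\<le>r. (-1) ^ Suc l * of_nat (r choose Suc l) * t (Suc l)) = (\<Sum>l\<le>Suc r. (-1) ^ l * of_nat (r choose l) * t l)"
    by (subst sum.atMost_Suc_shift) simp
  also have "\<dots> = (\<Sum>l\<le>r. (-1) ^ l * of_nat (r choose l) * t l)"
    by simp
  finally show ?thesis unfolding A B .
qed

text \<open>
  By the chain rule a substitution multiplies Cayley's operator by its determinant, here 1.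
\<close>
lemma omega_process_subst:
  fixes p q r s :: "'a::field_char_0"
  assumes "p * s - q * r = 1"
  defines "S \<equiv> \<lambda>F. subst_form F (linear_form p q) (linear_form r s)"
  shows "omega_process n (S F) (S G) = S (omega_process n F G)"
proof (induction n arbitrary: F G)
  case 0
  then show ?case by (simp add: omega_process_def S_def hom_subst)
next
  case (Suc n)
  have det: "cst p * cst s - cst q * cst r = 1"
    using arg_cong[OF assms(1), of cst] by (simp add: hom_cst)
  have "omega_process (Suc n) (S F) (S G) = (cst p * cst s - cst q * cst r) * S (omega_process n (D0 F) (D1 G))
     - (cst p * cst s - cst q * cst r) * S (omega_process n (D1 F) (D0 G))"
    unfolding omega_process_Suc S_def chain_rule omega_process_linear
    unfolding Suc.IH[unfolded S_def] by (simp add: algebra_simps)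
  also have "\<dots> = S (omega_process (Suc n) F G)"
    unfolding det omega_process_Suc by (simp add: S_def hom_subst)
  finally show ?case .
qed

lemma transvectant_subst:
  fixes p q r s :: "'a::field_char_0"
  assumes "p * s - q * r = 1"
  defines "S \<equiv> \<lambda>F. subst_form F (linear_form p q) (linear_form r s)"
  shows "transvectant m n l (S F) (S G) = S (transvectant m n l F G)"
  using omega_process_subst[OF assms(1), of l F G]
  unfolding transvectant_def omega_process_def[symmetric] S_def by (simp add: hom_subst generators_subst)

text \<open>
  A linear substitution fixes the origin. Together with \<open>transvectant_subst\<close> this gives the invariance
  of the basic invariants without any computation in coefficients.
\<close>
lemma const_val_subst: "const_val (subst_form F (linear_form p q) (linear_form r s)) = const_val F"
  by (induction F rule: bpoly_induct)
     (simp_all add: hom_subst generators_subst hom_const_val, simp_all add: const_val_def X0_def X1_def coeff_mult)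

lemma basic_invs_subst:
  fixes p q r s :: "'a::field_char_0"
  assumes "p * s - q * r = 1"
  shows "basic_invs (subst_form f (linear_form p q) (linear_form r s)) (subst_form g (linear_form p q) (linear_form r s)) = basic_invs f g"
  unfolding basic_invs_def Let_def transvectant_subst[OF assms] hom_subst(7)[symmetric] const_val_subst ..

lemma is_form_subst:
  fixes F :: "'a::comm_ring_1 bpoly"
  assumes "is_form n F"
  shows "is_form n (subst_form F (linear_form p q) (linear_form r s))"
proof -
  have linear_form: "is_form 1 (linear_form p q)" for p q :: 'a
    by (intro is_form_add is_form_cst_mult is_form_X)
  have "is_form n (linear_form p q ^ (n - j) * linear_form r s ^ j)" if "j \<le> n" for j
    using is_form_mult[OF is_form_power[OF linear_form, of "n - j" p q] is_form_power[OF linear_form, of j r s]] that by simp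
  then show ?thesis
    by (subst form_expansion[OF assms])
       (auto simp: hom_subst generators_subst intro!: is_form_sum is_form_cst_mult)
qed

lemma subst_inverse:
  fixes p q r s :: "'a::comm_ring_1"
  assumes "p * s - q * r = 1"
  shows "subst_form (subst_form F (linear_form p q) (linear_form r s)) (linear_form s (- q)) (linear_form (- r) p) = F"
proof -
  have det: "cst p * cst s - cst q * cst r = 1"
    using arg_cong[OF assms, of cst] by (simp add: hom_cst)
  let ?h = "\<lambda>F. subst_form (subst_form F (linear_form p q) (linear_form r s)) (linear_form s (- q)) (linear_form (- r) p)"
  have "?h X0 = (cst p * cst s - cst q * cst r) * X0" "?h X1 = (cst p * cst s - cst q * cst r) * X1"
    by (simp_all add: hom_subst generators_subst hom_cst algebra_simps)
  then have "?h X0 = X0" "?h X1 = X1"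
    by (simp_all only: det mult_1)
  moreover have "?h (cst a) = cst a" for a
    by (simp add: generators_subst)
  moreover have "is_hom ?h"
    by (rule is_hom_comp[OF is_hom_subst_form is_hom_subst_form])
  moreover have "is_hom (\<lambda>F :: 'a bpoly. F)"
    by (simp add: is_hom_def)
  ultimately show ?thesis
    using is_hom_ext[of ?h "\<lambda>F. F"] by blast
qed

section \<open>Conjugation of cubic maps\<close>

lemma matrix_inv_2:
  fixes p q r s :: "'a::field"
  assumes "p * s - q * r = 1"
  shows "matrix_inv (vector [vector [p, q], vector [r, s]] :: 'a ^ 2 ^ 2) = vector [vector [s, - q], vector [- r, p]]"
    (is "matrix_inv ?A = ?B")
proof -
  have "?A ** ?B = mat 1"
    using assms by (simp add: vec_eq_iff forall_2 matrix_matrix_mult_def sum_2 mat_def algebra_simps)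
  moreover have "det ?A \<noteq> 0"
    using assms by (simp add: det_2)
  then have "matrix_inv ?A ** ?A = mat 1"
    by (rule matrix_inv_cancel)
  ultimately show ?thesis
    using matrix_mul_assoc[of "matrix_inv ?A" ?A ?B] by simp
qed

text \<open>
  For \<open>\<gamma>\<close> of determinant 1 the assignment of \<open>(f, g)\<close> to \<open>\<phi>\<close> is equivariant: \<open>f\<close> is a
  divergence, and \<open>g\<close> is the determinant of \<open>(F\<^sub>0, F\<^sub>1)\<close> and \<open>(X0, X1)\<close>. The two components stay
  coprime because both the substitution and the linear recombination can be inverted.
\<close>
lemma conj_map_parts:
  fixes p q r s :: "'b::field_char_0"
  assumes det: "p * s - q * r = 1" and cubic: "cubic_map \<phi>"
  defines "\<gamma> \<equiv> vector [vector [p, q], vector [r, s]] :: 'b ^ 2 ^ 2"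
  shows "cubic_map (conj_map \<gamma> \<phi>)"
    and "quadratic_part (conj_map \<gamma> \<phi>) = subst_form (quadratic_part \<phi>) (linear_form p q) (linear_form r s)"
    and "quartic_part (conj_map \<gamma> \<phi>) = subst_form (quartic_part \<phi>) (linear_form p q) (linear_form r s)"
proof -
  define S where "S = (\<lambda>F. subst_form F (linear_form p q) (linear_form r s))"
  define S' where "S' = (\<lambda>F. subst_form F (linear_form s (- q)) (linear_form (- r) p))"
  obtain F0 F1 where \<phi>: "\<phi> = (F0, F1)" by (cases \<phi>) auto
  have conj: "conj_map \<gamma> \<phi> = (cst s * S F0 + cst (- q) * S F1, cst (- r) * S F0 + cst p * S F1)"
    by (simp add: conj_map_def \<gamma>_def matrix_inv_2[OF det] Let_def \<phi> S_def)
  have form: "is_form 3 F0" "is_form 3 F1" and cop: "coprime F0 F1"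
    using cubic by (auto simp: cubic_map_def \<phi>)
  have detc: "cst p * cst s - cst q * cst r = 1"
    using arg_cong[OF det, of cst] by (simp add: hom_cst)
  have S'S: "S' (S F) = F" and SS': "S (S' F) = F" for F
    using subst_inverse[OF det] subst_inverse[of s p "- q" "- r"] det unfolding S_def S'_def
    by (simp_all add: algebra_simps)
  have dvd: "S' F dvd S' G" if "F dvd G" for F G
    using that unfolding dvd_def S'_def by (metis hom_subst(4))
  have dvd': "S F dvd S G" if "F dvd G" for F G
    using that unfolding dvd_def S_def by (metis hom_subst(4))
  have "coprime (cst s * S F0 + cst (- q) * S F1) (cst (- r) * S F0 + cst p * S F1)" (is "coprime ?G0 ?G1")
  proof (rule coprimeI)
    fix c assume c: "c dvd ?G0" "c dvd ?G1"
    have "c dvd cst p * ?G0 + cst q * ?G1" "c dvd cst r * ?G0 + cst s * ?G1"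
      by (intro dvd_add dvd_mult c)+
    moreover have "cst p * ?G0 + cst q * ?G1 = S F0"
    proof -
      have "cst p * ?G0 + cst q * ?G1 = (cst p * cst s - cst q * cst r) * S F0"
        by (simp add: hom_cst algebra_simps)
      then show ?thesis by (simp add: detc)
    qed
    moreover have "cst r * ?G0 + cst s * ?G1 = S F1"
    proof -
      have "cst r * ?G0 + cst s * ?G1 = (cst p * cst s - cst q * cst r) * S F1"
        by (simp add: hom_cst algebra_simps)
      then show ?thesis by (simp add: detc)
    qed
    ultimately have "S' c dvd F0" "S' c dvd F1"
      using dvd[of c "S F0"] dvd[of c "S F1"] by (simp_all add: S'S)
    then have "S' c dvd 1"
      using cop unfolding coprime_def by blast
    then show "c dvd 1"
      using dvd'[of "S' c" 1] by (simp add: SS') (simp add: S_def hom_subst)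
  qed
  then show "cubic_map (conj_map \<gamma> \<phi>)"
    unfolding conj cubic_map_def fst_conv snd_conv S_def
    by (auto intro!: is_form_add is_form_cst_mult is_form_subst form)
  have "quadratic_part (conj_map \<gamma> \<phi>) = (cst p * cst s - cst q * cst r) * (S (D0 F0) + S (D1 F1))"
    unfolding conj quadratic_part_def fst_conv snd_conv D0_add D1_add D0_mult D1_mult
    unfolding S_def chain_rule by (simp add: hom_cst algebra_simps)
  then show "quadratic_part (conj_map \<gamma> \<phi>) = subst_form (quadratic_part \<phi>) (linear_form p q) (linear_form r s)"
    by (simp add: detc quadratic_part_def \<phi> S_def hom_subst)
  show "quartic_part (conj_map \<gamma> \<phi>) = subst_form (quartic_part \<phi>) (linear_form p q) (linear_form r s)"
    unfolding conj quartic_part_def fst_conv snd_conv S_def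
    by (simp add: \<phi> hom_subst generators_subst hom_cst algebra_simps)
qed

text \<open>
  Euler's identity for cubic forms inverts the map \<open>\<phi> \<mapsto> (f, g)\<close>.
\<close>
lemma cubic_map_of_parts:
  fixes \<phi> :: "'a::field_char_0 bpoly \<times> 'a bpoly"
  assumes "cubic_map \<phi>"
  shows "4 * fst \<phi> = D1 (quartic_part \<phi>) + X0 * quadratic_part \<phi>"
    and "4 * snd \<phi> = X1 * quadratic_part \<phi> - D0 (quartic_part \<phi>)"
proof -
  have euler: "X0 * D0 F + X1 * D1 F = 3 * F" if "is_form 3 F" for F :: "'a bpoly"
  proof -
    have "F = form_of_list [form_coeff F 3 0, form_coeff F 2 1, form_coeff F 1 2, form_coeff F 0 3]"
      by (subst form_of_list_cases[OF that]) (simp add: upt_rec numeral_eq_Suc)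
    moreover have "X0 * D0 F + X1 * D1 F = 3 * F" if "F = form_of_list [a, b, c, d]" for a b c d
      unfolding that by (simp add: form_of_list_def numeral_eq_Suc algebra_simps)
    ultimately show ?thesis by blast
  qed
  have "X0 * D0 (fst \<phi>) + X1 * D1 (fst \<phi>) = 3 * fst \<phi>" "X0 * D0 (snd \<phi>) + X1 * D1 (snd \<phi>) = 3 * snd \<phi>"
    using assms euler by (auto simp: cubic_map_def)
  then show "4 * fst \<phi> = D1 (quartic_part \<phi>) + X0 * quadratic_part \<phi>"
    and "4 * snd \<phi> = X1 * quadratic_part \<phi> - D0 (quartic_part \<phi>)"
    by (simp_all add: quadratic_part_def quartic_part_def algebra_simps)
qed

lemma parts_forms:
  fixes \<phi> :: "'a::field_char_0 bpoly \<times> 'a bpoly"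
  assumes "cubic_map \<phi>"
  shows "is_form 2 (quadratic_part \<phi>)" "is_form 4 (quartic_part \<phi>)"
proof -
  have *: "is_form 2 (D0 F)" "is_form 2 (D1 F)" if "is_form 3 F" for F :: "'a bpoly"
    unfolding is_form_def form_coeff_def[symmetric] form_coeff_D
    using that[unfolded is_form_def form_coeff_def[symmetric], rule_format, of "Suc _"]
      that[unfolded is_form_def form_coeff_def[symmetric], rule_format, of _ "Suc _"] by fastforce+
  have "is_form 3 (fst \<phi>)" "is_form 3 (snd \<phi>)"
    using assms by (auto simp: cubic_map_def)
  then show "is_form 2 (quadratic_part \<phi>)"
    unfolding quadratic_part_def by (intro is_form_add *)
  have "is_form (1 + 3) (X1 * fst \<phi> + - (X0 * snd \<phi>))"
    using assms unfolding cubic_map_def by (intro is_form_add is_form_uminus is_form_mult is_form_X) auto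
  then show "is_form 4 (quartic_part \<phi>)"
    by (simp add: quartic_part_def)
qed

section \<open>Change of field and of scale\<close>

definition lift_vec :: "'a::field ^ 'n \<Rightarrow> 'a alg_closure ^ 'n" where
  "lift_vec u = (\<chi> i. to_ac (u $ i))"

definition lift_mat :: "'a::field ^ 'n ^ 'm \<Rightarrow> 'a alg_closure ^ 'n ^ 'm" where
  "lift_mat M = (\<chi> i. lift_vec (M $ i))"

lemma lift_quadratic: "lift_form (quadratic u) = quadratic (lift_vec u)"
  by (simp add: quadratic_eq hom_lift generators_lift lift_vec_def)

lemma lift_quartic: "lift_form (quartic g0 g1 g2 g3 g4) = quartic (to_ac g0) (to_ac g1) (to_ac g2) (to_ac g3) (to_ac g4)"
  by (simp add: quartic_eq hom_lift generators_lift)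

lemma basic_invs_lift:
  assumes "is_form 2 f" "is_form 4 g"
  shows "basic_invs (lift_form f) (lift_form g) = lift_inv (basic_invs f g)"
proof -
  obtain u where f: "f = quadratic u" using assms(1) by (rule quadratic_form_cases)
  obtain g0 g1 g2 g3 g4 where g: "g = quartic g0 g1 g2 g3 g4" using assms(2) by (rule quartic_form_cases)
  show ?thesis
    unfolding f g lift_quadratic lift_quartic basic_invs_eq Let_def
    by (simp add: lift_vec_def discr_form_def quartic_pairing_def)
qed

lemma basic_invs_scale:
  assumes "is_form 2 f" "is_form 4 g"
  shows "basic_invs (cst t * f) (cst t * g) = wscale t (basic_invs f g)"
proof -
  obtain u where f: "f = quadratic u" using assms(1) by (rule quadratic_form_cases)
  obtain g0 g1 g2 g3 g4 where g: "g = quartic g0 g1 g2 g3 g4" using assms(2) by (rule quartic_form_cases)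
  have "cst t * f = quadratic (t *s u)" "cst t * g = quartic (t * g0) (t * g1) (t * g2) (t * g3) (t * g4)"
    unfolding f g by (simp_all add: quadratic_eq quartic_eq hom_cst algebra_simps)
  then show ?thesis
    unfolding f g by (simp add: basic_invs_eq Let_def discr_form_def quartic_pairing_def field_simps power2_eq_square numeral_eq_Suc)
qed

lemma invariants_lift:
  "c_tilde (lift_inv v) = to_ac (c_tilde v)" "A_tilde (lift_inv v) = lift_vec (A_tilde v)"
  "B_tilde (lift_inv v) = lift_mat (B_tilde v)" "C_tilde (lift_inv v) = lift_mat (C_tilde v)"
  by (cases v; simp add: vec_eq_iff forall_3 lift_vec_def lift_mat_def)+

lemma lift_mat_mult: "lift_mat (M ** N) = lift_mat M ** lift_mat N"
  by (simp add: lift_mat_def lift_vec_def matrix_matrix_mult_def to_ac_sum vec_eq_iff)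

lemma lift_mat_simps: "lift_mat (transpose M) = transpose (lift_mat M)" "lift_mat discr_matrix_inv = discr_matrix_inv"
  by (simp_all add: lift_mat_def lift_vec_def transpose_def vec_eq_iff forall_3 discr_matrix_inv_def)

lemma det_lift_mat: "det (lift_mat M) = to_ac (det M)" for M :: "'a::field ^ 3 ^ 3"
  by (simp add: det_3 lift_mat_def lift_vec_def)

lemma det_C_tilde: "det (C_tilde v) = 2 * (c_tilde v)\<^sup>2"
  by (cases v) (simp add: det_3 field_simps power2_eq_square)

lemma C_tilde_symmetric: "C_tilde v $ i $ j = C_tilde v $ j $ i"
proof -
  have "\<forall>i j. C_tilde v $ i $ j = C_tilde v $ j $ i"
    by (cases v) (simp add: forall_3)
  then show ?thesis by blast
qed

lemma wscale_simps: "wscale 1 v = v" "wscale s (wscale t v) = wscale (s * t) v"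
  by (cases v, simp) (cases v, simp add: power_mult_distrib mult.assoc)

lemma in_own_wpoint: "v \<in> wpoint v"
  unfolding wpoint_def using wscale_simps(1)[of v] by (auto intro!: exI[of _ 1])

text \<open>
  The dual basis of the covariants. Its Gram matrix and its determinant are functions of \<open>v\<close>, and
  \<open>f\<close> and \<open>g\<close> are functions of \<open>v\<close> and of the dual basis.
\<close>
lemma covariant_dual_basis:
  fixes f g :: "'a::field_char_0 bpoly"
  assumes "is_form 2 f" "is_form 4 g" and v: "basic_invs f g = v" and c: "c_tilde v \<noteq> 0"
  obtains V where "\<And>i j. discr_form (V $ i) (V $ j) = matrix_inv (C_tilde v) $ i $ j"
    "det V = - 1 / (2 * c_tilde v)"
    "transpose V ** C_tilde v ** V = discr_matrix_inv"
    "f = (\<Sum>i\<in>UNIV. cst (A_tilde v $ i) * quadratic (V $ i))"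
    "g = (\<Sum>i\<in>UNIV. \<Sum>j\<in>UNIV. cst (B_tilde v $ i $ j) * quadratic (V $ i) * quadratic (V $ j))"
proof -
  obtain u where f: "f = quadratic u" using assms(1) by (rule quadratic_form_cases)
  obtain g0 g1 g2 g3 g4 where g: "g = quartic g0 g1 g2 g3 g4" using assms(2) by (rule quartic_form_cases)
  define U where "U = covariant_rows g0 g1 g2 g3 g4 u"
  note gram = gram_covariants[OF v[unfolded f g], folded U_def]
  define V where "V = matrix_inv (C_tilde v) ** U"
  have C: "det (C_tilde v) \<noteq> 0"
    using c by (simp add: det_C_tilde)
  note dual = dual_basis[OF gram(1) C, folded V_def]
  have "U $ 1 = u"
    by (simp add: U_def covariant_rows_def Let_def)
  then have "f = (\<Sum>i\<in>UNIV. cst (A_tilde v $ i) * quadratic (V $ i))"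
    using reconstruct_quadratic[OF gram(3) dual(2)] f by simp
  moreover have "g = (\<Sum>i\<in>UNIV. \<Sum>j\<in>UNIV. cst (B_tilde v $ i $ j) * quadratic (V $ i) * quadratic (V $ j))"
    using reconstruct_quartic[OF gram(2) dual(1)] g by simp
  moreover have "det (C_tilde v) * det V = det U"
    by (metis dual(2) det_mul)
  then have "c_tilde v * (2 * c_tilde v * det V) = c_tilde v * - 1"
    by (simp add: gram(4) det_C_tilde power2_eq_square mult_ac)
  then have "2 * c_tilde v * det V = - 1"
    using c by (simp only: mult_cancel_left) simp
  then have "det V = - 1 / (2 * c_tilde v)"
    using c by (simp add: field_simps)
  ultimately show ?thesis
    using that dual by blast
qed

text \<open>
  By \<open>special_orthogonal_is_sym2\<close> the rows of \<open>W\<close> arise from the dual basis of the covariants of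
  \<open>\<phi>\<close> by a substitution of determinant 1, and a substitution commutes with the sums that recover
  \<open>f\<close> and \<open>g\<close>.
\<close>
lemma twist_of_dual_basis:
  fixes \<phi> :: "'b::{field_char_0, alg_closed_field} bpoly \<times> 'b bpoly"
  assumes \<phi>: "cubic_map \<phi>" and v: "basic_invs (quadratic_part \<phi>) (quartic_part \<phi>) = v" and c: "c_tilde v \<noteq> 0"
    and W: "\<And>i j. discr_form (W $ i) (W $ j) = matrix_inv (C_tilde v) $ i $ j" "det W = - 1 / (2 * c_tilde v)"
  obtains p q r s where "p * s - q * r = 1"
    "quadratic_part (conj_map (vector [vector [p, q], vector [r, s]]) \<phi>) =
      (\<Sum>i\<in>UNIV. cst (A_tilde v $ i) * quadratic (W $ i))"
    "quartic_part (conj_map (vector [vector [p, q], vector [r, s]]) \<phi>) =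
      (\<Sum>i\<in>UNIV. \<Sum>j\<in>UNIV. cst (B_tilde v $ i $ j) * quadratic (W $ i) * quadratic (W $ j))"
proof -
  obtain V where V: "\<And>i j. discr_form (V $ i) (V $ j) = matrix_inv (C_tilde v) $ i $ j" "det V = - 1 / (2 * c_tilde v)"
    and f: "quadratic_part \<phi> = (\<Sum>i\<in>UNIV. cst (A_tilde v $ i) * quadratic (V $ i))"
    and g: "quartic_part \<phi> = (\<Sum>i\<in>UNIV. \<Sum>j\<in>UNIV. cst (B_tilde v $ i $ j) * quadratic (V $ i) * quadratic (V $ j))"
    by (rule covariant_dual_basis[OF parts_forms[OF \<phi>] v c]) (rule that; assumption)
  obtain p q r s where det: "p * s - q * r = 1" and WV: "\<And>i. W $ i = sym2 p q r s (V $ i)"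
    by (rule special_orthogonal_is_sym2[of W V]) (use V W c in auto)
  show ?thesis
  proof (rule that[OF det])
    show "quadratic_part (conj_map (vector [vector [p, q], vector [r, s]]) \<phi>) =
      (\<Sum>i\<in>UNIV. cst (A_tilde v $ i) * quadratic (W $ i))"
      unfolding conj_map_parts(2)[OF det \<phi>] f WV quadratic_sym2 by (simp add: hom_subst generators_subst)
    show "quartic_part (conj_map (vector [vector [p, q], vector [r, s]]) \<phi>) =
      (\<Sum>i\<in>UNIV. \<Sum>j\<in>UNIV. cst (B_tilde v $ i $ j) * quadratic (W $ i) * quadratic (W $ j))"
      unfolding conj_map_parts(3)[OF det \<phi>] g WV quadratic_sym2 by (simp add: hom_subst generators_subst)
  qed
qed

lemma cubic_map_scale:
  fixes \<phi> :: "'b::field_char_0 bpoly \<times> 'b bpoly"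
  assumes "cubic_map \<phi>" "t \<noteq> 0"
  shows "cubic_map (cst t * fst \<phi>, cst t * snd \<phi>)"
    "quadratic_part (cst t * fst \<phi>, cst t * snd \<phi>) = cst t * quadratic_part \<phi>"
    "quartic_part (cst t * fst \<phi>, cst t * snd \<phi>) = cst t * quartic_part \<phi>"
proof -
  have "cst t * cst (1 / t) = 1"
    unfolding hom_cst(4)[symmetric] using assms(2) by (simp add: hom_cst)
  then have "cst t dvd 1" by (metis dvd_triv_left)
  then show "cubic_map (cst t * fst \<phi>, cst t * snd \<phi>)"
    using assms(1) by (auto simp: cubic_map_def is_form_cst_mult coprime_mult_left_iff coprime_mult_right_iff intro: is_unit_left_imp_coprime is_unit_right_imp_coprime)
qed (simp_all add: quadratic_part_def quartic_part_def algebra_simps)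

text \<open>
  Multiplying both components of a map by \<open>t\<close> acts on its invariants by \<open>wscale t\<close>, so every
  coordinate vector of a moduli point, not just some multiple of it, is attained.
\<close>
lemma cubic_map_with_invariants:
  assumes "P \<in> M3" "P = wpoint v"
  obtains \<phi> where "cubic_map \<phi>" "basic_invs (quadratic_part \<phi>) (quartic_part \<phi>) = v"
proof -
  obtain \<phi> where \<phi>: "cubic_map \<phi>" "P = wpoint (basic_invs (quadratic_part \<phi>) (quartic_part \<phi>))"
    using assms(1) by (auto simp: M3_def moduli_point_def)
  then obtain t where t: "t \<noteq> 0" "v = wscale t (basic_invs (quadratic_part \<phi>) (quartic_part \<phi>))"
    using in_own_wpoint[of v] assms(2) by (auto simp: wpoint_def)
  show ?thesis
    using that[of "(cst t * fst \<phi>, cst t * snd \<phi>)"] cubic_map_scale[OF \<phi>(1) t(1)]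
      basic_invs_scale[OF parts_forms[OF \<phi>(1)]] t(2) by metis
qed

lemma gram_of_conic_equation:
  fixes C W :: "'a::field_char_0 ^ 3 ^ 3"
  assumes "transpose W ** C ** W = discr_matrix_inv" "det C \<noteq> 0"
  shows "discr_form (W $ i) (W $ j) = matrix_inv C $ i $ j"
proof -
  have "transpose W ** (C ** W ** discr_matrix) = mat 1"
    by (simp add: matrix_mul_assoc assms(1) discr_matrix_inverse)
  then have "C ** W ** discr_matrix ** transpose W = mat 1"
    by (simp add: matrix_left_right_inverse)
  then have "C ** (W ** discr_matrix ** transpose W) = mat 1"
    by (simp add: matrix_mul_assoc)
  then have "matrix_inv C ** C ** (W ** discr_matrix ** transpose W) = matrix_inv C"
    by (simp flip: matrix_mul_assoc)
  then show ?thesis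
    by (simp add: matrix_inv_cancel[OF assms(2)] flip: gram_matrix)
qed

text \<open>
  The point is the dual basis of the covariants evaluated at \<open>(X0, X1) = (1, 0)\<close>, where a quadratic
  form takes the value of its first coefficient.
\<close>
lemma conic_point_of_forms:
  fixes f g :: "'a::field_char_0 bpoly"
  assumes "is_form 2 f" "is_form 4 g" and v: "basic_invs f g = v" and c: "c_tilde v \<noteq> 0"
  shows "conic_points (C_tilde v) \<noteq> {}"
proof -
  obtain V where V: "transpose V ** C_tilde v ** V = discr_matrix_inv" "det V = - 1 / (2 * c_tilde v)"
    by (rule covariant_dual_basis[OF assms])
  \<comment> \<open>The first coefficients of the three forms, that is, their values at \<open>(1, 0)\<close>.\<close>
  define x where "x = transpose V $ 1"
  have "x \<noteq> 0"
  proof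
    assume "x = 0"
    then have "V $ i $ 1 = 0" for i by (simp add: x_def transpose_def vec_eq_iff)
    then have "det V = 0" by (simp add: det_3)
    then show False using V(2) c by simp
  qed
  moreover have "(\<Sum>i\<in>UNIV. \<Sum>j\<in>UNIV. C_tilde v $ i $ j * x $ i * x $ j) = (transpose V ** C_tilde v ** V) $ 1 $ 1"
    by (simp add: x_def transpose_def matrix_matrix_mult_def sum_3 algebra_simps)
  ultimately have "x \<in> conic_points (C_tilde v)"
    by (simp add: conic_points_def V(1) discr_matrix_inv_def)
  then show ?thesis by blast
qed

section \<open>Parametrizations of conics\<close>

definition conic_form :: "'a::comm_ring_1 ^ 3 ^ 3 \<Rightarrow> 'a ^ 3 \<Rightarrow> 'a ^ 3 \<Rightarrow> 'a" where
  "conic_form C x y = (\<Sum>i\<in>UNIV. \<Sum>j\<in>UNIV. C $ i $ j * x $ i * y $ j)"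

text \<open>
  A nondegenerate conic contains no line. For any third vector \<open>w\<close> the Gram matrix of \<open>y\<close>, \<open>z\<close>, \<open>w\<close>
  has a vanishing 2 by 2 block, hence determinant 0, and so \<open>det (y, z, w) = 0\<close>.
\<close>
lemma isotropic_pair_dependent:
  fixes C :: "'a::field ^ 3 ^ 3"
  assumes "det C \<noteq> 0" and 0: "conic_form C y y = 0" "conic_form C y z = 0" "conic_form C z y = 0" "conic_form C z z = 0"
  shows "y $ i * z $ j = y $ j * z $ i"
proof -
  have det0: "det (vector [y, z, w] :: 'a ^ 3 ^ 3) = 0" for w
  proof -
    define M where "M = (vector [y, z, w] :: 'a ^ 3 ^ 3)"
    have "(M ** C ** transpose M) $ i $ j = conic_form C (M $ i) (M $ j)" for i j
      by (simp add: conic_form_def transpose_def matrix_matrix_mult_def sum_3 algebra_simps)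
    then have "det (M ** C ** transpose M) = 0"
      using 0 by (simp add: det_3 M_def)
    then show ?thesis
      using assms(1) by (simp add: det_mul M_def)
  qed
  have "\<forall>i j. y $ i * z $ j = y $ j * z $ i"
    using det0[of "vector [1, 0, 0]"] det0[of "vector [0, 1, 0]"] det0[of "vector [0, 0, 1]"]
    by (simp add: forall_3 det_3 algebra_simps)
  then show ?thesis by blast
qed

lemma conic_form_symmetric:
  assumes "\<And>i j. C $ i $ j = C $ j $ i"
  shows "conic_form C x y = conic_form C y x"
  unfolding conic_form_def by (subst sum.swap) (simp add: assms mult_ac)

lemma index3_complement:
  fixes k :: 3
  obtains i j where "i \<noteq> j" "i \<noteq> k" "j \<noteq> k" "UNIV = {i, j, k}"
proof -
  have "\<forall>k :: 3. \<exists>i j. i \<noteq> j \<and> i \<noteq> k \<and> j \<noteq> k \<and> (\<forall>l. l = i \<or> l = j \<or> l = k)"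
    unfolding forall_3
    by (intro conjI, rule exI[of _ 2], rule exI[of _ 3], simp, rule exI[of _ 1], rule exI[of _ 3], simp,
        rule exI[of _ 1], rule exI[of _ 2], simp)
  then show ?thesis using that by blast
qed

text \<open>
  Inverse of the projection from \<open>Q\<close>. If \<open>Q\<^sub>k \<noteq> 0\<close> and \<open>i\<close>, \<open>j\<close> are the other two indices, the lines through \<open>Q\<close> are spanned by \<open>Q\<close> and \<open>y = X0 e\<^sub>i + X1 e\<^sub>j\<close>, and the second
  intersection of such a line with the conic is \<open>C(y, y) Q - 2 C(Q, y) y\<close>. It never vanishes, since
  \<open>C(y, y) = C(Q, y) = 0\<close> would put the whole line on the conic.
\<close>
lemma conic_param_exists:
  fixes C :: "'a::field_char_0 ^ 3 ^ 3"
  assumes Q: "Q \<in> conic_points C" and sym: "\<And>i j. C $ i $ j = C $ j $ i" and C: "det C \<noteq> 0"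
  obtains \<theta> where "conic_param C Q \<theta>"
proof -
  from Q obtain k where k: "Q $ k \<noteq> 0"
    by (auto simp: conic_points_def vec_eq_iff)
  obtain i j where ij: "i \<noteq> j" "i \<noteq> k" "j \<noteq> k" and U: "UNIV = {i, j, k}"
    by (rule index3_complement)
  have sum_U: "(\<Sum>l\<in>UNIV. h l) = h i + h j + h k" for h :: "3 \<Rightarrow> 'c::comm_monoid_add"
    unfolding U using ij by (simp add: add.assoc)
  have cover: "Pr l" if "Pr i" "Pr j" "Pr k" for Pr and l :: 3
  proof -
    have "l \<in> {i, j, k}" unfolding U[symmetric] by simp
    then show ?thesis using that by auto
  qed
  \<comment> \<open>The components of \<open>C Q\<close>; below, \<open>N\<close> is \<open>C(y, y)\<close> and \<open>L\<close> is \<open>C(Q, y)\<close> for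
    \<open>y = X0 e\<^sub>i + X1 e\<^sub>j\<close>.\<close>
  define \<alpha> where "\<alpha> = (\<lambda>l. C $ l $ i * Q $ i + C $ l $ j * Q $ j + C $ l $ k * Q $ k)"
  define N :: "'a bpoly" where "N = cst (C $ i $ i) * X0\<^sup>2 + 2 * cst (C $ i $ j) * X0 * X1 + cst (C $ j $ j) * X1\<^sup>2"
  define L :: "'a bpoly" where "L = cst (\<alpha> i) * X0 + cst (\<alpha> j) * X1"
  define \<theta> where "\<theta> = (\<chi> l. cst (Q $ l) * N - 2 * L * (if l = i then X0 else if l = j then X1 else 0))"
  have \<theta>: "\<theta> $ i = cst (Q $ i) * N - 2 * L * X0" "\<theta> $ j = cst (Q $ j) * N - 2 * L * X1" "\<theta> $ k = cst (Q $ k) * N"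
    using ij by (simp_all add: \<theta>_def)
  have QQ: "Q $ i * \<alpha> i + Q $ j * \<alpha> j + Q $ k * \<alpha> k = 0"
    using Q unfolding conic_points_def sum_U \<alpha>_def by (simp add: algebra_simps)
  have "is_form 2 N"
    unfolding N_def using is_form_quadratic[of "vector [C $ i $ i, C $ i $ j, C $ j $ j]"] by (simp add: quadratic_eq)
  have "is_form 1 L"
    unfolding L_def by (intro is_form_add is_form_cst_mult is_form_X)
  have "is_form 2 (cst 2 * (L * X0))" "is_form 2 (cst 2 * (L * X1))"
    using is_form_mult[OF \<open>is_form 1 L\<close> is_form_X(1)] is_form_mult[OF \<open>is_form 1 L\<close> is_form_X(2)]
    by (auto intro!: is_form_cst_mult simp: numeral_2_eq_2)
  then have "is_form 2 (2 * L * X0)" "is_form 2 (2 * L * X1)"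
    by (simp_all add: hom_cst mult.assoc)
  then have "is_form 2 (\<theta> $ i)" "is_form 2 (\<theta> $ j)" "is_form 2 (\<theta> $ k)"
    unfolding \<theta> by (auto intro!: is_form_diff is_form_cst_mult \<open>is_form 2 N\<close>)
  then have forms: "is_form 2 (\<theta> $ l)" for l
    by (rule cover[of "\<lambda>l. is_form 2 (\<theta> $ l)"])
  have on_conic: "(\<Sum>l\<in>UNIV. \<Sum>m\<in>UNIV. cst (C $ l $ m) * \<theta> $ l * \<theta> $ m) = 0"
  proof -
    have C': "C $ j $ i = C $ i $ j" "C $ k $ i = C $ i $ k" "C $ k $ j = C $ j $ k"
      by (rule sym)+
    have "(\<Sum>l\<in>UNIV. \<Sum>m\<in>UNIV. cst (C $ l $ m) * \<theta> $ l * \<theta> $ m) =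
      cst (Q $ i * \<alpha> i + Q $ j * \<alpha> j + Q $ k * \<alpha> k) * N\<^sup>2 - 4 * N * L * L + 4 * L\<^sup>2 * N"
    proof -
      have L: "L = (cst (C $ i $ i) * cst (Q $ i) + cst (C $ i $ j) * cst (Q $ j) + cst (C $ i $ k) * cst (Q $ k)) * X0
          + (cst (C $ i $ j) * cst (Q $ i) + cst (C $ j $ j) * cst (Q $ j) + cst (C $ j $ k) * cst (Q $ k)) * X1"
        by (simp add: L_def \<alpha>_def C' hom_cst)
      have "(\<Sum>l\<in>UNIV. \<Sum>m\<in>UNIV. cst (C $ l $ m) * \<theta> $ l * \<theta> $ m) =
        cst (Q $ i * \<alpha> i + Q $ j * \<alpha> j + Q $ k * \<alpha> k) * N\<^sup>2
        - 4 * N * L * ((cst (C $ i $ i) * cst (Q $ i) + cst (C $ i $ j) * cst (Q $ j) + cst (C $ i $ k) * cst (Q $ k)) * X0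
          + (cst (C $ i $ j) * cst (Q $ i) + cst (C $ j $ j) * cst (Q $ j) + cst (C $ j $ k) * cst (Q $ k)) * X1)
        + 4 * L\<^sup>2 * (cst (C $ i $ i) * X0\<^sup>2 + 2 * cst (C $ i $ j) * X0 * X1 + cst (C $ j $ j) * X1\<^sup>2)"
        unfolding sum_U \<theta> C' \<alpha>_def hom_cst by (simp add: algebra_simps power2_eq_square)
      then show ?thesis
        unfolding L[symmetric] N_def[symmetric] .
    qed
    also have "\<dots> = 0"
      unfolding QQ by (simp add: hom_cst power2_eq_square)
    finally show ?thesis .
  qed
  have base_point_free: "\<exists>l. eval_form (lift_form (\<theta> $ l)) x0 x1 \<noteq> 0" if x: "(x0, x1) \<noteq> (0, 0)" for x0 x1
  proof (rule ccontr)
    assume "\<not> ?thesis"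
    then have 0: "eval_form (lift_form (\<theta> $ l)) x0 x1 = 0" for l by blast
    define n where "n = eval_form (lift_form N) x0 x1"
    define m where "m = eval_form (lift_form L) x0 x1"
    have "to_ac (Q $ i) * n = 2 * m * x0" "to_ac (Q $ j) * n = 2 * m * x1" "to_ac (Q $ k) * n = 0"
      using 0[of i] 0[of j] 0[of k] unfolding \<theta> by (simp_all add: hom_lift hom_eval generators_lift generators_eval n_def m_def)
    then have "n = 0" "m = 0"
      using k x by auto
    define y where "y = (\<chi> l. if l = i then x0 else if l = j then x1 else 0)"
    have y: "y $ i = x0" "y $ j = x1" "y $ k = 0"
      using ij by (simp_all add: y_def)
    have sym': "conic_form (lift_mat C) z w = conic_form (lift_mat C) w z" for z w
      by (rule conic_form_symmetric) (simp add: lift_mat_def lift_vec_def sym)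
    have "conic_form (lift_mat C) y y = n"
      unfolding conic_form_def sum_U y n_def N_def
      by (simp add: hom_lift hom_eval generators_lift generators_eval lift_mat_def lift_vec_def sym[of j i] algebra_simps power2_eq_square)
    moreover have "conic_form (lift_mat C) y (lift_vec Q) = m"
      unfolding conic_form_def sum_U y m_def L_def \<alpha>_def
      by (simp add: hom_lift hom_eval generators_lift generators_eval lift_mat_def lift_vec_def algebra_simps)
    moreover have "conic_form (lift_mat C) (lift_vec Q) (lift_vec Q) = to_ac (Q $ i * \<alpha> i + Q $ j * \<alpha> j + Q $ k * \<alpha> k)"
      unfolding conic_form_def sum_U \<alpha>_def by (simp add: lift_mat_def lift_vec_def algebra_simps)
    ultimately have "y $ l * lift_vec Q $ k = y $ k * lift_vec Q $ l" for l
      using \<open>n = 0\<close> \<open>m = 0\<close> QQ C sym'[of "lift_vec Q" y]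
      by (intro isotropic_pair_dependent[of "lift_mat C"]) (simp_all add: det_lift_mat)
    from this[of i] this[of j] show False
      using x k by (auto simp: y lift_vec_def)
  qed
  \<comment> \<open>The linear forms that vanish at \<open>Q\<close> and are dual to \<open>e\<^sub>i\<close>, \<open>e\<^sub>j\<close>.\<close>
  define m where "m = (\<chi> l. if l = i then 1 else if l = j then 0 else - Q $ i / Q $ k)"
  define n where "n = (\<chi> l. if l = i then 0 else if l = j then 1 else - Q $ j / Q $ k)"
  have mn: "m $ i = 1" "m $ j = 0" "m $ k = - Q $ i / Q $ k" "n $ i = 0" "n $ j = 1" "n $ k = - Q $ j / Q $ k"
    using ij by (simp_all add: m_def n_def)
  have "((\<Sum>l\<in>UNIV. m $ l * x $ l) = 0 \<and> (\<Sum>l\<in>UNIV. n $ l * x $ l) = 0) \<longleftrightarrow> (\<exists>t. x = t *s Q)" for x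
  proof
    assume "(\<Sum>l\<in>UNIV. m $ l * x $ l) = 0 \<and> (\<Sum>l\<in>UNIV. n $ l * x $ l) = 0"
    moreover define t where "t = x $ k / Q $ k"
    ultimately have "x $ i = t * Q $ i" "x $ j = t * Q $ j" "x $ k = t * Q $ k"
      unfolding sum_U mn t_def using k by (simp_all add: field_simps)
    then have "x $ l = t * Q $ l" for l
      by (rule cover[of "\<lambda>l. x $ l = t * Q $ l"])
    then have "x = t *s Q" by (simp add: vec_eq_iff)
    then show "\<exists>t. x = t *s Q" ..
  next
    assume "\<exists>t. x = t *s Q"
    then show "(\<Sum>l\<in>UNIV. m $ l * x $ l) = 0 \<and> (\<Sum>l\<in>UNIV. n $ l * x $ l) = 0"
      unfolding sum_U mn using k by auto
  qed
  moreover have "X1 * (\<Sum>l\<in>UNIV. cst (m $ l) * \<theta> $ l) = X0 * (\<Sum>l\<in>UNIV. cst (n $ l) * \<theta> $ l)"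
  proof -
    have "cst (- Q $ l / Q $ k) * cst (Q $ k) = - cst (Q $ l)" for l
      unfolding hom_cst(4)[symmetric] using k by (simp add: hom_cst)
    then have "(\<Sum>l\<in>UNIV. cst (m $ l) * \<theta> $ l) = - 2 * L * X0" "(\<Sum>l\<in>UNIV. cst (n $ l) * \<theta> $ l) = - 2 * L * X1"
      unfolding sum_U mn \<theta> mult.assoc[symmetric] by (simp_all add: hom_cst)
    then show ?thesis by simp
  qed
  ultimately have "conic_param C Q \<theta>"
    unfolding conic_param_def using forms base_point_free on_conic by blast
  then show ?thesis by (rule that)
qed

lemma quadratic_mult:
  "quadratic u * quadratic w = form_of_list [u $ 1 * w $ 1, 2 * (u $ 1 * w $ 2 + u $ 2 * w $ 1),
     u $ 1 * w $ 3 + 4 * u $ 2 * w $ 2 + u $ 3 * w $ 1, 2 * (u $ 2 * w $ 3 + u $ 3 * w $ 2), u $ 3 * w $ 3]"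
  by (simp add: quadratic_eq form_of_list_def hom_cst numeral_eq_Suc) (simp add: algebra_simps)

lemma form_of_list_eq_iff: "form_of_list as = form_of_list bs \<longleftrightarrow> as = bs" if "length as = length bs"
proof
  assume eq: "form_of_list as = form_of_list bs"
  show "as = bs"
  proof (rule nth_equalityI[OF that])
    fix j assume "j < length as"
    then show "as ! j = bs ! j"
      using arg_cong[OF eq, of "\<lambda>F. form_coeff F (length as - Suc j) j"] that
      by (cases "length bs") (simp_all add: form_coeff_of_list)
  qed
qed simp

text \<open>
  The five coefficients of the quartic \<open>\<Sum> C\<^sub>i\<^sub>j \<theta>\<^sub>i \<theta>\<^sub>j\<close>, expressed by the columns of the
  coefficient matrix of \<open>\<theta>\<close>.
\<close>
lemma conic_equation_columns:
  fixes C T :: "'a::field_char_0 ^ 3 ^ 3"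
  assumes eq: "(\<Sum>i\<in>UNIV. \<Sum>j\<in>UNIV. cst (C $ i $ j) * quadratic (T $ i) * quadratic (T $ j)) = 0"
    and sym: "\<And>i j. C $ i $ j = C $ j $ i"
  defines "t \<equiv> \<lambda>k. transpose T $ k"
  shows "conic_form C (t 1) (t 1) = 0" "conic_form C (t 1) (t 2) = 0" "conic_form C (t 1) (t 3) = - 2 * conic_form C (t 2) (t 2)"
    "conic_form C (t 2) (t 3) = 0" "conic_form C (t 3) (t 3) = 0"
proof -
  have "form_coeff (\<Sum>i\<in>UNIV. \<Sum>j\<in>UNIV. cst (C $ i $ j) * quadratic (T $ i) * quadratic (T $ j)) m n =
      (\<Sum>i\<in>UNIV. \<Sum>j\<in>UNIV. C $ i $ j * form_coeff (quadratic (T $ i) * quadratic (T $ j)) m n)" for m n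
    by (simp only: form_coeff_linear mult.assoc)
  then have form_coeff: "(\<Sum>i\<in>UNIV. \<Sum>j\<in>UNIV. C $ i $ j * form_coeff (quadratic (T $ i) * quadratic (T $ j)) m n) = 0" for m n
    using eq by (simp add: form_coeff_linear)
  note coeffs = form_coeff[unfolded quadratic_mult form_coeff_of_list]
  have C': "C $ 2 $ 1 = C $ 1 $ 2" "C $ 3 $ 1 = C $ 1 $ 3" "C $ 3 $ 2 = C $ 2 $ 3"
    by (rule sym)+
  show "conic_form C (t 1) (t 1) = 0"
    using coeffs[of 4 0] by (simp add: conic_form_def t_def transpose_def algebra_simps)
  show "conic_form C (t 3) (t 3) = 0"
    using coeffs[of 0 4] by (simp add: conic_form_def t_def transpose_def algebra_simps)
  have "4 * conic_form C (t 1) (t 2) = 0"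
    using coeffs[of 3 1] unfolding conic_form_def t_def transpose_def sum_3 C' by (simp add: algebra_simps)
  then show "conic_form C (t 1) (t 2) = 0" by simp
  have "4 * conic_form C (t 2) (t 3) = 0"
    using coeffs[of 1 3] unfolding conic_form_def t_def transpose_def sum_3 C' by (simp add: algebra_simps)
  then show "conic_form C (t 2) (t 3) = 0" by simp
  have "2 * (conic_form C (t 1) (t 3) + 2 * conic_form C (t 2) (t 2)) = 0"
    using coeffs[of 2 2] unfolding conic_form_def t_def transpose_def sum_3 C' by (simp add: algebra_simps)
  then have "conic_form C (t 1) (t 3) + 2 * conic_form C (t 2) (t 2) = 0"
    unfolding mult_eq_0_iff by simp
  then show "conic_form C (t 1) (t 3) = - 2 * conic_form C (t 2) (t 2)"
    by (simp add: eq_neg_iff_add_eq_0)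
qed

lemma quadratic_form_has_zero:
  fixes u :: "'b::{field_char_0, alg_closed_field} ^ 3"
  obtains x0 x1 where "(x0, x1) \<noteq> (0, 0)" "eval_form (quadratic u) x0 x1 = 0"
proof (cases "u $ 1 = 0")
  case True
  then show ?thesis
    by (intro that[of 1 0]) (simp_all add: quadratic_eq hom_eval generators_eval)
next
  case False
  obtain x where "(\<Sum>k\<le>2. (if k = 0 then u $ 3 else if k = 1 then 2 * u $ 2 else u $ 1) * x ^ k) = 0"
    using alg_closed[of 2 "\<lambda>k. if k = 0 then u $ 3 else if k = 1 then 2 * u $ 2 else u $ 1"] False by auto
  then have "eval_form (quadratic u) x 1 = 0"
    by (simp add: quadratic_eq hom_eval generators_eval numeral_2_eq_2 atMost_Suc algebra_simps)
  then show ?thesis by (intro that[of x 1]) simp_all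
qed

lemma quadratic_sum: "(\<Sum>i\<in>UNIV. cst (m $ i) * quadratic (T $ i)) = quadratic (m v* T)"
  for m :: "'a::comm_ring_1 ^ 3"
  by (simp add: sum_3 quadratic_eq vector_matrix_mult_def hom_cst algebra_simps)

text \<open>
  The conic equation already makes \<open>T\<^sup>T C T\<close> a multiple of \<open>D\<^sup>-\<^sup>1\<close>, because \<open>D\<^sup>-\<^sup>1\<close> spans the
  quadratic relations between \<open>X0\<^sup>2\<close>, \<open>2 X0 X1\<close> and \<open>X1\<^sup>2\<close>. If the factor were 0, the columns of \<open>T\<close> would span a
  totally isotropic space, so they would be proportional. The projection from \<open>Q\<close> would then be
  constant, against its being the identity of the projective line, unless all columns are multiples of
  \<open>Q\<close>; but then a zero of a quadratic form in the algebraic closure is a base point of \<open>\<theta>\<close>.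
\<close>
lemma conic_param_normal_form:
  fixes C :: "'a::field_char_0 ^ 3 ^ 3"
  assumes \<theta>: "conic_param C Q \<theta>" and sym: "\<And>i j. C $ i $ j = C $ j $ i" and C: "det C \<noteq> 0"
  obtains T \<mu> where "\<And>i. \<theta> $ i = quadratic (T $ i)" "transpose T ** C ** T = (\<chi> i j. \<mu> * discr_matrix_inv $ i $ j)" "\<mu> \<noteq> 0"
proof -
  have "\<exists>u. \<theta> $ i = quadratic u" for i
  proof -
    have "is_form 2 (\<theta> $ i)" using \<theta> by (simp add: conic_param_def)
    then show ?thesis by (rule quadratic_form_cases) blast
  qed
  then obtain T' where "\<And>i. \<theta> $ i = quadratic (T' i)" by metis
  then obtain T where T: "\<And>i. \<theta> $ i = quadratic (T $ i)"
    by (metis vec_lambda_beta)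
  define t where "t k = transpose T $ k" for k
  note cols = conic_equation_columns[OF \<theta>[unfolded conic_param_def T, THEN conjunct2, THEN conjunct2, THEN conjunct1] sym, folded t_def]
  note conic_form_sym = conic_form_symmetric[of C, OF sym]
  define \<mu> where "\<mu> = conic_form C (t 1) (t 3)"
  have "(transpose T ** C ** T) $ i $ j = conic_form C (t i) (t j)" for i j
    by (simp add: conic_form_def t_def transpose_def matrix_matrix_mult_def sum_3 algebra_simps)
  moreover have "\<forall>i j. conic_form C (t i) (t j) = \<mu> * discr_matrix_inv $ i $ j"
    unfolding forall_3 using cols conic_form_sym[of "t 2" "t 1"] conic_form_sym[of "t 3" "t 1"] conic_form_sym[of "t 3" "t 2"]
    by (simp add: \<mu>_def discr_matrix_inv_def)
  ultimately have eq: "transpose T ** C ** T = (\<chi> i j. \<mu> * discr_matrix_inv $ i $ j)"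
    by (simp add: vec_eq_iff)
  have "\<mu> \<noteq> 0"
  proof
    assume "\<mu> = 0"
    then have isotropic: "conic_form C (t k) (t l) = 0" for k l
      using \<open>\<forall>i j. conic_form C (t i) (t j) = \<mu> * discr_matrix_inv $ i $ j\<close> by simp
    then have dep: "t k $ i * t l $ j = t k $ j * t l $ i" for i j k l
      by (intro isotropic_pair_dependent[OF C])
    obtain m n where ker: "\<And>x. (\<Sum>i\<in>UNIV. m $ i * x $ i) = 0 \<and> (\<Sum>i\<in>UNIV. n $ i * x $ i) = 0 \<longleftrightarrow> (\<exists>t. x = t *s Q)"
      and proj: "X1 * quadratic (m v* T) = X0 * quadratic (n v* T)"
      using \<theta>[unfolded conic_param_def T, THEN conjunct2, THEN conjunct2, THEN conjunct2] unfolding quadratic_sum by blast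
    \<comment> \<open>The values of the two linear forms on the columns of \<open>T\<close>.\<close>
    define a where "a k = (\<Sum>i\<in>UNIV. m $ i * t k $ i)" for k
    define b where "b k = (\<Sum>i\<in>UNIV. n $ i * t k $ i)" for k
    have ab: "(m v* T) $ k = a k" "(n v* T) $ k = b k" for k
      by (simp_all add: a_def b_def t_def transpose_def vector_matrix_mult_def mult.commute)
    have "X1 * quadratic (m v* T) = form_of_list [0, a 1, 2 * a 2, a 3]"
      "X0 * quadratic (n v* T) = form_of_list [b 1, 2 * b 2, b 3, 0]"
      by (simp_all add: quadratic_eq form_of_list_def hom_cst ab numeral_eq_Suc algebra_simps)
    then have "form_of_list [0, a 1, 2 * a 2, a 3] = form_of_list [b 1, 2 * b 2, b 3, 0]"
      using proj by simp
    then have proj_coeffs: "b 1 = 0" "a 1 = 2 * b 2" "b 3 = 2 * a 2" "a 3 = 0"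
      by (auto simp: form_of_list_eq_iff)
    have "a k * b l = b k * a l" for k l
    proof -
      have "a k * b l - b k * a l = (\<Sum>i\<in>UNIV. \<Sum>j\<in>UNIV. m $ i * n $ j * (t k $ i * t l $ j - t k $ j * t l $ i))"
        unfolding a_def b_def sum_3 by (simp add: algebra_simps)
      also have "\<dots> = 0"
        by (intro sum.neutral ballI) (simp add: dep[of k _ l])
      finally show ?thesis by simp
    qed
    from this[of 1 2] this[of 2 3] have "b 2 * b 2 = 0" "a 2 * a 2 = 0"
      by (simp_all add: proj_coeffs)
    then have "a k = 0 \<and> b k = 0" for k
      using proj_coeffs exhaust_3[of k] by auto
    then have "\<exists>\<tau>. t k = \<tau> *s Q" for k
      using ker[of "t k"] by (simp add: a_def b_def)
    then obtain \<tau> where "\<And>k. t k = \<tau> k *s Q" by metis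
    then have "T $ i $ k = Q $ i * \<tau> k" for i k
      unfolding t_def transpose_def by (simp add: vec_eq_iff)
    then have \<theta>': "\<theta> $ i = cst (Q $ i) * quadratic (\<chi> k. \<tau> k)" for i
      by (simp add: T quadratic_eq hom_cst algebra_simps)
    obtain x0 x1 where "(x0, x1) \<noteq> (0, 0)" "eval_form (quadratic (lift_vec (\<chi> k. \<tau> k))) x0 x1 = 0"
      by (rule quadratic_form_has_zero)
    moreover from this have "eval_form (lift_form (\<theta> $ i)) x0 x1 = 0" for i
      by (simp add: \<theta>' hom_lift hom_eval lift_quadratic)
    ultimately show False
      using \<theta> unfolding conic_param_def by blast
  qed
  with T eq show ?thesis by (rule that)
qed

text \<open>
  Taking determinants in \<open>T\<^sup>T C T = \<mu> D\<^sup>-\<^sup>1\<close> gives \<open>4 c\<^sup>2 (det T)\<^sup>2 = \<mu>\<^sup>3\<close> with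
  \<open>c = c_tilde v\<close>, so \<open>\<mu>\<close> is a
  square in the base field. Dividing by a square root gives the Gram matrix of a dual basis, and the
  choice of the root fixes the sign of the determinant.
\<close>
lemma conic_param_dual_basis:
  assumes \<theta>: "conic_param (C_tilde v) Q \<theta>" and c: "c_tilde v \<noteq> 0"
  obtains W \<kappa> where "\<kappa> \<noteq> 0" "\<And>i. \<theta> $ i = cst \<kappa> * quadratic (W $ i)"
    "transpose W ** C_tilde v ** W = discr_matrix_inv" "det W = - 1 / (2 * c_tilde v)"
proof -
  have C: "det (C_tilde v) \<noteq> 0" using c by (simp add: det_C_tilde)
  obtain T \<mu> where T: "\<And>i. \<theta> $ i = quadratic (T $ i)"
    and eq: "transpose T ** C_tilde v ** T = (\<chi> i j. \<mu> * discr_matrix_inv $ i $ j)" and "\<mu> \<noteq> 0"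
    by (rule conic_param_normal_form[OF \<theta> C_tilde_symmetric C]) (rule that; assumption)
  have \<mu>3: "det (\<chi> i j. \<mu> * discr_matrix_inv $ i $ j :: 'a ^ 3 ^ 3) = \<mu> ^ 3 / 2"
    by (simp add: det_3 discr_matrix_inv_def power3_eq_cube)
  then have det: "4 * (c_tilde v)\<^sup>2 * (det T)\<^sup>2 = \<mu> ^ 3"
    using arg_cong[OF eq, of det] unfolding \<mu>3 by (simp add: det_mul det_C_tilde field_simps power2_eq_square)
  \<comment> \<open>The sign makes the determinant of \<open>W\<close> equal to that of the dual basis, not its negative.\<close>
  define \<kappa> where "\<kappa> = - 2 * c_tilde v * det T / \<mu>"
  have sq: "\<kappa>\<^sup>2 = \<mu>"
    using det \<open>\<mu> \<noteq> 0\<close> by (simp add: \<kappa>_def power_divide power_mult_distrib power2_eq_square power3_eq_cube field_simps)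
  then have "\<kappa> \<noteq> 0" using \<open>\<mu> \<noteq> 0\<close> by auto
  define W where "W = (\<chi> i. (1 / \<kappa>) *s (T $ i))"
  have TW: "T $ i $ j = \<kappa> * W $ i $ j" for i j
    using \<open>\<kappa> \<noteq> 0\<close> by (simp add: W_def)
  have "\<theta> $ i = cst \<kappa> * quadratic (W $ i)" for i
    by (simp add: T quadratic_eq TW hom_cst algebra_simps)
  moreover have "transpose W ** C_tilde v ** W = discr_matrix_inv"
  proof -
    have "(transpose T ** C_tilde v ** T) $ i $ j = \<kappa>\<^sup>2 * (transpose W ** C_tilde v ** W) $ i $ j" for i j
      by (simp add: transpose_def matrix_matrix_mult_def TW sum_3 algebra_simps power2_eq_square)
    then have "\<mu> * discr_matrix_inv $ i $ j = \<mu> * (transpose W ** C_tilde v ** W) $ i $ j" for i j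
      unfolding eq sq by simp
    then show ?thesis
      using \<open>\<mu> \<noteq> 0\<close> by (simp add: vec_eq_iff)
  qed
  moreover have "det W = - 1 / (2 * c_tilde v)"
  proof -
    have "det T = \<kappa> ^ 3 * det W"
      by (simp add: det_3 TW algebra_simps power3_eq_cube)
    moreover have "\<kappa> ^ 3 = \<kappa> * \<mu>"
      by (simp add: power3_eq_cube sq[symmetric] power2_eq_square)
    moreover have "\<kappa> * \<mu> = - 2 * c_tilde v * det T"
      using \<open>\<mu> \<noteq> 0\<close> by (simp add: \<kappa>_def)
    ultimately have "(\<kappa> * \<mu>) * (2 * c_tilde v * det W) = (\<kappa> * \<mu>) * - 1"
      by (simp add: algebra_simps)
    then have "2 * c_tilde v * det W = - 1"
      using \<open>\<kappa> \<noteq> 0\<close> \<open>\<mu> \<noteq> 0\<close> by (simp only: mult_cancel_left) simp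
    then show ?thesis
      using c by (simp add: field_simps)
  qed
  ultimately show ?thesis
    using that \<open>\<kappa> \<noteq> 0\<close> by blast
qed

section \<open>Models over the base field\<close>

text \<open>
  The normalized parametrization has the Gram matrix and the determinant required by
  \<open>twist_of_dual_basis\<close>. Hence the two sums over \<open>k\<close> become, over the algebraic closure, the pair of a
  conjugate of a cubic map with invariants \<open>v\<close>.
\<close>
lemma model_of_conic_param:
  fixes P :: "'k::field_char_0 alg_closure inv6 set" and v :: "'k inv6"
  assumes P: "P \<in> M3" "P = wpoint (lift_inv v)" and c: "c_tilde v \<noteq> 0"
    and \<theta>: "conic_param (C_tilde v) Q \<theta>"
  shows "\<exists>\<beta> :: 'k. \<beta> \<noteq> 0 \<and>
    is_model_over_base P
      (cst (1 / (\<beta> * c_tilde v)) * (\<Sum>i\<in>UNIV. cst (A_tilde v $ i) * \<theta> $ i))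
      (cst (1 / (\<beta>\<^sup>2 * (c_tilde v)\<^sup>2)) * (\<Sum>i\<in>UNIV. \<Sum>j\<in>UNIV. cst (B_tilde v $ i $ j) * \<theta> $ i * \<theta> $ j))"
proof -
  obtain W \<kappa> where "\<kappa> \<noteq> 0" and \<theta>W: "\<And>i. \<theta> $ i = cst \<kappa> * quadratic (W $ i)"
    and W: "transpose W ** C_tilde v ** W = discr_matrix_inv" "det W = - 1 / (2 * c_tilde v)"
    by (rule conic_param_dual_basis[OF \<theta> c]) (rule that; assumption)
  define \<beta> where "\<beta> = \<kappa> / c_tilde v"
  define f where "f = (\<Sum>i\<in>UNIV. cst (A_tilde v $ i) * quadratic (W $ i))"
  define g where "g = (\<Sum>i\<in>UNIV. \<Sum>j\<in>UNIV. cst (B_tilde v $ i $ j) * quadratic (W $ i) * quadratic (W $ j))"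
  have \<beta>: "\<beta> \<noteq> 0" "\<beta> * c_tilde v = \<kappa>"
    using c \<open>\<kappa> \<noteq> 0\<close> by (simp_all add: \<beta>_def)
  have 1: "cst (1 / \<kappa>) * cst \<kappa> = 1"
    unfolding hom_cst(4)[symmetric] using \<open>\<kappa> \<noteq> 0\<close> by (simp add: hom_cst)
  have "cst (1 / (\<beta> * c_tilde v)) * (\<Sum>i\<in>UNIV. cst (A_tilde v $ i) * \<theta> $ i) = (cst (1 / \<kappa>) * cst \<kappa>) * f"
    unfolding \<beta> f_def \<theta>W sum_distrib_left by (simp add: mult_ac)
  then have f: "cst (1 / (\<beta> * c_tilde v)) * (\<Sum>i\<in>UNIV. cst (A_tilde v $ i) * \<theta> $ i) = f"
    by (simp only: 1 mult_1)
  have "cst (1 / (\<beta>\<^sup>2 * (c_tilde v)\<^sup>2)) = cst (1 / \<kappa>) * cst (1 / \<kappa>)"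
    unfolding \<beta>(2)[symmetric] hom_cst(4)[symmetric] by (simp add: power2_eq_square mult_ac)
  then have "cst (1 / (\<beta>\<^sup>2 * (c_tilde v)\<^sup>2)) * (\<Sum>i\<in>UNIV. \<Sum>j\<in>UNIV. cst (B_tilde v $ i $ j) * \<theta> $ i * \<theta> $ j)
      = (cst (1 / \<kappa>) * cst \<kappa>) * ((cst (1 / \<kappa>) * cst \<kappa>) * g)"
    unfolding g_def \<theta>W sum_distrib_left by (simp add: mult_ac)
  then have g: "cst (1 / (\<beta>\<^sup>2 * (c_tilde v)\<^sup>2)) * (\<Sum>i\<in>UNIV. \<Sum>j\<in>UNIV. cst (B_tilde v $ i $ j) * \<theta> $ i * \<theta> $ j) = g"
    by (simp only: 1 mult_1)
  have forms: "is_form 2 f" "is_form 4 g"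
    unfolding f_def g_def using is_form_mult[OF is_form_quadratic is_form_quadratic]
    by (auto intro!: is_form_sum is_form_cst_mult is_form_quadratic simp: mult.assoc)
  obtain \<phi> where \<phi>: "cubic_map \<phi>" "basic_invs (quadratic_part \<phi>) (quartic_part \<phi>) = lift_inv v"
    using cubic_map_with_invariants[OF P] .
  have c': "c_tilde (lift_inv v) \<noteq> 0" using c by (simp add: invariants_lift)
  have "transpose (lift_mat W) ** C_tilde (lift_inv v) ** lift_mat W = discr_matrix_inv"
    unfolding invariants_lift using arg_cong[OF W(1), of lift_mat] by (simp add: lift_mat_mult lift_mat_simps)
  then have gram: "discr_form (lift_mat W $ i) (lift_mat W $ j) = matrix_inv (C_tilde (lift_inv v)) $ i $ j" for i j
    by (rule gram_of_conic_equation) (use c' in \<open>simp add: det_C_tilde\<close>)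
  have det: "det (lift_mat W) = - 1 / (2 * c_tilde (lift_inv v))"
    by (simp add: det_lift_mat W(2) invariants_lift)
  obtain p q r s where pqrs: "p * s - q * r = 1"
    and "quadratic_part (conj_map (vector [vector [p, q], vector [r, s]]) \<phi>) =
      (\<Sum>i\<in>UNIV. cst (A_tilde (lift_inv v) $ i) * quadratic (lift_mat W $ i))"
    and "quartic_part (conj_map (vector [vector [p, q], vector [r, s]]) \<phi>) =
      (\<Sum>i\<in>UNIV. \<Sum>j\<in>UNIV. cst (B_tilde (lift_inv v) $ i $ j) * quadratic (lift_mat W $ i) * quadratic (lift_mat W $ j))"
    by (rule twist_of_dual_basis[OF \<phi> c' gram det])
  then have parts: "quadratic_part (conj_map (vector [vector [p, q], vector [r, s]]) \<phi>) = lift_form f"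
    "quartic_part (conj_map (vector [vector [p, q], vector [r, s]]) \<phi>) = lift_form g"
    by (simp_all add: f_def g_def hom_lift generators_lift lift_quadratic invariants_lift, simp_all add: lift_vec_def lift_mat_def)
  have "basic_invs (lift_form f) (lift_form g) = lift_inv v"
    unfolding parts[symmetric] conj_map_parts(2,3)[OF pqrs \<phi>(1)] basic_invs_subst[OF pqrs] \<phi>(2) ..
  then have "is_model_over_base P f g"
    unfolding is_model_over_base_def is_model_def moduli_point_def
    using forms parts conj_map_parts(1)[OF pqrs \<phi>(1)] P(2) by metis
  then show ?thesis
    using \<beta>(1) by (intro exI[of _ \<beta>]) (simp only: f g simp_thms)
qed

text \<open>
  The hypothesis on \<open>v\<close> means \<open>j = a = 0\<close>. The pair \<open>(- f, - g)\<close> then has the invariants \<open>v\<close> too, so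
  \<open>twist_of_dual_basis\<close> yields \<open>\<gamma>\<close> that maps \<open>(f, g)\<close> to \<open>(- f, - g)\<close>. It conjugates \<open>\<phi>\<close> to
  \<open>- \<phi>\<close>, which is the same rational map. A scalar matrix of determinant 1 would fix \<open>f \<noteq> 0\<close>.
\<close>
lemma aut_of_odd_invariants_zero:
  fixes P :: "'b::{field_char_0, alg_closed_field} inv6 set"
  assumes P: "P \<in> M3" "P = wpoint v" and c: "c_tilde v \<noteq> 0" and v: "wscale (- 1) v = v"
  shows "P \<in> M3_Aut"
proof -
  obtain \<phi> where \<phi>: "cubic_map \<phi>" "basic_invs (quadratic_part \<phi>) (quartic_part \<phi>) = v"
    using cubic_map_with_invariants[OF P] .
  note forms = parts_forms[OF \<phi>(1)]
  have "basic_invs (- quadratic_part \<phi>) (- quartic_part \<phi>) = v"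
    using basic_invs_scale[OF forms, of "- 1"] v by (simp add: hom_cst \<phi>(2))
  then obtain W where W: "\<And>i j. discr_form (W $ i) (W $ j) = matrix_inv (C_tilde v) $ i $ j" "det W = - 1 / (2 * c_tilde v)"
    and fW: "- quadratic_part \<phi> = (\<Sum>i\<in>UNIV. cst (A_tilde v $ i) * quadratic (W $ i))"
    and gW: "- quartic_part \<phi> = (\<Sum>i\<in>UNIV. \<Sum>j\<in>UNIV. cst (B_tilde v $ i $ j) * quadratic (W $ i) * quadratic (W $ j))"
    by (rule covariant_dual_basis[OF is_form_uminus[OF forms(1)] is_form_uminus[OF forms(2)] _ c]) (rule that; assumption)
  obtain p q r s where pqrs: "p * s - q * r = 1"
    and parts: "quadratic_part (conj_map (vector [vector [p, q], vector [r, s]]) \<phi>) = - quadratic_part \<phi>"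
      "quartic_part (conj_map (vector [vector [p, q], vector [r, s]]) \<phi>) = - quartic_part \<phi>"
    unfolding fW gW by (rule twist_of_dual_basis[OF \<phi> c W])
  define \<gamma> where "\<gamma> = (vector [vector [p, q], vector [r, s]] :: 'b ^ 2 ^ 2)"
  have "4 * fst (conj_map \<gamma> \<phi>) = 4 * - fst \<phi>" "4 * snd (conj_map \<gamma> \<phi>) = 4 * - snd \<phi>"
    using cubic_map_of_parts[OF \<phi>(1)] cubic_map_of_parts[OF conj_map_parts(1)[OF pqrs \<phi>(1)]]
    by (simp_all add: \<gamma>_def parts)
  then have "fst (conj_map \<gamma> \<phi>) = - fst \<phi>" "snd (conj_map \<gamma> \<phi>) = - snd \<phi>"
    by (simp_all only: mult_cancel_left) simp_all
  then have "same_map \<phi> (conj_map \<gamma> \<phi>)"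
    unfolding same_map_def by (intro exI[of _ "- 1"]) (simp add: hom_cst)
  moreover have "invertible \<gamma>"
    using pqrs by (simp add: invertible_det_nz \<gamma>_def det_2)
  moreover have "\<gamma> \<noteq> mat t" for t
  proof
    assume "\<gamma> = mat t"
    then have t: "p = t" "q = 0" "r = 0" "s = t"
      unfolding \<gamma>_def by (simp_all add: vec_eq_iff forall_2 mat_def)
    obtain u where u: "quadratic_part \<phi> = quadratic u"
      using forms(1) by (rule quadratic_form_cases)
    have "sym2 p q r s u = u"
      using pqrs by (simp add: sym2_def t vec_eq_iff forall_3 power2_eq_square)
    then have "- quadratic_part \<phi> = quadratic_part \<phi>"
      using parts(1)[unfolded conj_map_parts(2)[OF pqrs \<phi>(1)]] u quadratic_sym2[of p q r s u] by simp
    then have "quadratic_part \<phi> + quadratic_part \<phi> = 0"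
      by (metis add.left_inverse)
    then have "2 * quadratic_part \<phi> = 0"
      by (simp only: mult_2)
    then have "quadratic_part \<phi> = quadratic 0"
      by (simp add: quadratic_eq hom_cst)
    moreover obtain g0 g1 g2 g3 g4 where "quartic_part \<phi> = quartic g0 g1 g2 g3 g4"
      using forms(2) by (rule quartic_form_cases)
    ultimately have "c_tilde v = 0"
      unfolding \<phi>(2)[symmetric] by (simp add: basic_invs_eq Let_def discr_form_def quartic_pairing_def)
    then show False using c by simp
  qed
  ultimately show ?thesis
    unfolding M3_Aut_def Aut_GL_def moduli_point_def using P \<phi> by blast
qed
lemma lift_inv_eq_iff: "lift_inv v = lift_inv w \<longleftrightarrow> v = w"
  by (cases v; cases w) simp

lemma lift_inv_wscale: "lift_inv (wscale s v) = wscale (to_ac s) (lift_inv v)"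
  by (cases v) simp

text \<open>
  The invariants of the model are \<open>t \<cdot> v\<close> with \<open>t\<close> in the algebraic closure. Once \<open>t\<close> is known to
  lie in the base field, the model can be rescaled to have invariants \<open>v\<close>. Two consecutive powers of
  \<open>t\<close> in the base field suffice: \<open>t\<^sup>2\<close> comes from \<open>d\<close>, and \<open>t\<^sup>3\<close> from \<open>a\<close> or \<open>j\<close>.
\<close>
lemma conic_point_of_model:
  fixes P :: "'k::field_char_0 alg_closure inv6 set" and v :: "'k inv6"
  assumes P: "P \<in> M3" "P = wpoint (lift_inv v)" and c: "c_tilde v \<noteq> 0"
    and no_aut: "P \<notin> M3_Aut" and model: "is_model_over_base P f g"
  shows "conic_points (C_tilde v) \<noteq> {}"
proof -
  have forms: "is_form 2 f" "is_form 4 g" and "wpoint (basic_invs (lift_form f) (lift_form g)) = wpoint (lift_inv v)"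
    using model P(2) by (auto simp: is_model_over_base_def is_model_def moduli_point_def)
  then obtain t where t: "t \<noteq> 0" "lift_inv (basic_invs f g) = wscale t (lift_inv v)"
    using in_own_wpoint[of "basic_invs (lift_form f) (lift_form g)"] by (auto simp: basic_invs_lift[OF forms] wpoint_def)
  obtain d i j a b e where v: "v = (d, i, j, a, b, e)" by (cases v) auto
  obtain d' i' j' a' b' e' where w: "basic_invs f g = (d', i', j', a', b', e')" by (cases "basic_invs f g") auto
  have eqs: "to_ac d' = t\<^sup>2 * to_ac d" "to_ac j' = t ^ 3 * to_ac j" "to_ac a' = t ^ 3 * to_ac a"
    using t(2) by (simp_all add: v w)
  show ?thesis
  proof (cases "d = 0")
    case True
    then have "vector [1, 0, 0] \<in> conic_points (C_tilde v)"
      by (simp add: conic_points_def sum_3 v vec_eq_iff forall_3)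
    then show ?thesis by blast
  next
    case False
    then have t2: "t\<^sup>2 = to_ac (d' / d)"
      using eqs(1) by (simp add: field_simps)
    have "a \<noteq> 0 \<or> j \<noteq> 0"
    proof (rule ccontr)
      assume "\<not> ?thesis"
      then have "wscale (- 1) (lift_inv v) = lift_inv v" by (simp add: v)
      then have "P \<in> M3_Aut"
        using aut_of_odd_invariants_zero[OF P] c by (simp add: invariants_lift)
      then show False using no_aut by simp
    qed
    then obtain z where t3: "t ^ 3 = to_ac z"
    proof
      assume "a \<noteq> 0"
      then show ?thesis using eqs(3) by (intro that[of "a' / a"]) (simp add: field_simps)
    next
      assume "j \<noteq> 0"
      then show ?thesis using eqs(2) by (intro that[of "j' / j"]) (simp add: field_simps)
    qed
    define s where "s = z / (d' / d)"
    have "t = t ^ 3 / t\<^sup>2"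
      using t(1) by (simp add: power2_eq_square power3_eq_cube)
    then have ts: "t = to_ac s"
      unfolding t2 t3 s_def by (simp only: to_ac_divide)
    then have "s \<noteq> 0" using t(1) by auto
    have "basic_invs f g = wscale s v"
      using t(2) by (simp add: ts lift_inv_wscale[symmetric] lift_inv_eq_iff)
    then have "basic_invs (cst (1 / s) * f) (cst (1 / s) * g) = v"
      using \<open>s \<noteq> 0\<close> by (simp add: basic_invs_scale[OF forms] wscale_simps)
    then show ?thesis
      using conic_point_of_forms[OF is_form_cst_mult[OF forms(1)] is_form_cst_mult[OF forms(2)] _ c] by blast
  qed
qed

theorem theorem4p4:
  fixes P :: "'k::field_char_0 alg_closure inv6 set"
    and v :: "'k inv6"
  assumes "P \<in> M3"
    and "P = wpoint (lift_inv v)"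
    and "c_tilde v \<noteq> 0"
  shows "(\<forall>Q \<in> conic_points (C_tilde v).
            (\<exists>\<theta>. conic_param (C_tilde v) Q \<theta>) \<and>
            (\<forall>\<theta>. conic_param (C_tilde v) Q \<theta> \<longrightarrow>
               (\<exists>\<beta> :: 'k. \<beta> \<noteq> 0 \<and>
                  is_model_over_base P
                    (cst (1 / (\<beta> * c_tilde v)) *
                       (\<Sum>i\<in>UNIV. cst (A_tilde v $ i) * \<theta> $ i))
                    (cst (1 / (\<beta>\<^sup>2 * (c_tilde v)\<^sup>2)) *
                       (\<Sum>i\<in>UNIV. \<Sum>j\<in>UNIV. cst (B_tilde v $ i $ j) * \<theta> $ i * \<theta> $ j))))) \<and>
         (conic_points (C_tilde v) \<noteq> {} \<longrightarrow> (\<exists>f g. is_model_over_base P f g)) \<and>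
         (P \<notin> M3_Aut \<longrightarrow>
            (conic_points (C_tilde v) \<noteq> {} \<longleftrightarrow> (\<exists>f g. is_model_over_base P f g)))"
proof -
  have param: "\<exists>\<theta>. conic_param (C_tilde v) Q \<theta>" if "Q \<in> conic_points (C_tilde v)" for Q
    by (rule conic_param_exists[OF that C_tilde_symmetric]) (use assms(3) in \<open>auto simp: det_C_tilde\<close>)
  note model = model_of_conic_param[OF assms]
  have "\<exists>f g. is_model_over_base P f g" if "conic_points (C_tilde v) \<noteq> {}"
    using that param model by blast
  then show ?thesis
    using param model conic_point_of_model[OF assms] by blast
qed

end
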